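(* Let $(g,\lambda,1)$ be an orthosymmetric real type and let $\tau\in\mathcal H_{g,\lambda,1}$. Then all the elements of the families $\mathcal O(\tau)$ and $\mathcal E(\tau)$ are real. Moreover, let $\tilde\tau\in\mathcal H_{g,\lambda,1}$ be such that $\tilde\tau=\mathfrak M(G,\tau)$ for some $G\in\mathbb G_{g,\lambda,1}$. Then $\mathcal O(\tilde\tau)=\mathcal O(\tau)$ and $\mathcal E(\tilde\tau)=\mathcal E(\tau)$ up to permutations of the indexes (i.e. there are bijections $\pi$ of $\mathcal O_{g,\lambda,1}$ and $\pi'$ of $\mathcal E_{g,\lambda,1}$ onto themselves matching the values of the two families). Consequently, the elements of $\mathcal O(\tau)$ and of $\mathcal E(\tau)$ constitute multi-dimensional real quantities associated to the real principally polarized abelian variety $(A(\tau),S_{conj})$ which are invariant, up to permutations, under real isomorphisms: if $\tau,\tilde\tau\in\mathcal H_{g,\lambda,1}$ and $(A(\tau),S_{conj})$, $(A(\tilde\tau),S_{conj})$ are isomorphic as real principally polarized abelian varieties, then $\mathcal O(\tau),\mathcal O(\tilde\tau)$ coincide up to a permutation of indexes, and so do $\mathcal E(\tau),\mathcal E(\tilde\tau)$.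
   Context: A real type is a triple of integers $(g,\lambda,\varepsilon)$ with $g\ge 1$, $\varepsilon\in\{0,1\}$, $0\le\lambda\le g$, $\lambda$ even if $\varepsilon=1$ and $\lambda\ge1$ if $\varepsilon=0$; it is orthosymmetric if $\varepsilon=1$. For an orthosymmetric type write $\lambda=2\lambda_0$ and let $M=M_{g,\lambda,1}$ be the $g\times g$ matrix $\begin{bmatrix} M_{\lambda,\lambda,1}&0\\0&0\end{bmatrix}$ with $M_{\lambda,\lambda,1}=\begin{bmatrix}0&\mathrm{Id}_{\lambda_0}\\ \mathrm{Id}_{\lambda_0}&0\end{bmatrix}$. $\mathcal H_g$ is the Siegel upper half space of complex symmetric $g\times g$ matrices with positive definite imaginary part, and $\mathcal H_{g,\lambda,1}=\{\tau\in\mathcal H_g: 2\,\mathrm{Re}(\tau)=M\}$. The real modular group is $$\mathbb G_{g,\lambda,1}=\left\{\begin{bmatrix}A&\tfrac12(M-AMA^{\top})(A^{\top})^{-1}\\0&(A^{\top})^{-1}\end{bmatrix}: A\in \mathrm{GL}(g,\mathbb Z),\ M\equiv AMA^{\top}\bmod 2\right\}\le \mathrm{Sp}(2g,\mathbb Z),$$ and it acts on $\mathcal H_{g,\lambda,1}$ by $\mathfrak M(G,\tau)=A\tau A^{\top}+\tfrac12(M-AMA^{\top})$. For $\beta\in\mathbb Z^g$ the theta constant is $\Theta\left[\begin{smallmatrix}0\\ \beta\end{smallmatrix}\right](\tau)=\sum_{m\in\mathbb Z^g}\exp(\pi i\, m^{\top}\tau m+\pi i\,\beta^{\top}m)$;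 it depends only on the class $[\beta]_2\in\mathbb Z_2^g$ of $\beta$ modulo 2. Put $$\mathcal O_{g,\lambda,1}=\{[\beta]_2\in\mathbb Z_2^g:\ \beta^{\top}M\beta\equiv2\bmod 4,\ \beta_{\lambda+1}\equiv\dots\equiv\beta_g\equiv0\bmod 2\},$$ $$\mathcal E_{g,\lambda,1}=\{[\beta]_2\in\mathbb Z_2^g:\ \beta^{\top}M\beta\equiv0\bmod 4,\ \beta_{\lambda+1}\equiv\dots\equiv\beta_g\equiv0\bmod 2\},$$ and for $\tau\in\mathcal H_{g,\lambda,1}$ define the indexed families $\mathcal O(\tau)=\{\Theta\left[\begin{smallmatrix}0\\ \beta\end{smallmatrix}\right](\tau)\}_{[\beta]_2\in\mathcal O_{g,\lambda,1}}$ and $\mathcal E(\tau)=\{\Theta\left[\begin{smallmatrix}0\\ \beta\end{smallmatrix}\right](\tau)\}_{[\beta]_2\in\mathcal E_{g,\lambda,1}}$. A real principally polarized abelian variety is a principally polarized abelian variety $(X,E)$ with an anti-holomorphic involution $S$ of $X$ such that $S(0)=0$ and $E(S_\star c_1,S_\star c_2)=-E(c_1,c_2)$ on $H_1(X,\mathbb Z)$; real isomorphisms are isomorphisms of principally polarized abelian varieties commuting with the involutions. $A(\tau)$ is the torus $\mathbb C^g/\Lambda(\tau)$, with $\Lambda(\tau)=\mathbb Z^g+\tau\mathbb Z^g$, with polarization given by the standard symplectic form in the basis of columns of $[\mathrm{Id}\,|\,\tau]$, and $S_{conj}([z])=[\bar z]$. *)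

theory Defs
  imports "HOL-Analysis.Analysis" "HOL-Library.Z2" "HOL-Number_Theory.Cong"
begin

section \<open>Real types and the matrix of an orthosymmetric type\<close>

definition real_type :: "nat \<Rightarrow> nat \<Rightarrow> nat \<Rightarrow> bool" where
  "real_type g l e \<longleftrightarrow>
     1 \<le> g \<and> e \<in> {0, 1} \<and> l \<le> g \<and> (e = 1 \<longrightarrow> even l) \<and> (e = 0 \<longrightarrow> 1 \<le> l)"

definition orthosymmetric :: "nat \<Rightarrow> nat \<Rightarrow> nat \<Rightarrow> bool" where
  "orthosymmetric g l e \<longleftrightarrow> real_type g l e \<and> e = 1"

text \<open>
  The dimension \<open>g\<close> is \<open>CARD('g)\<close> for an index type of class \<open>{finite, linorder}\<close>; \<open>pos i\<close> is the
  position of the index \<open>i\<close> in the linear order, counted from 0, so that the indices of position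
  smaller than \<open>l\<close> are the indices \<open>1, \<dots>, l\<close> of the mathematical text.
\<close>

definition pos :: "'g::{finite,linorder} \<Rightarrow> nat" where
  "pos i = card {j. j < i}"

type_synonym ('a, 'n) sqmat = "(('a, 'n) vec, 'n) vec"

definition type_matrix :: "nat \<Rightarrow> (int, 'g::{finite,linorder}) sqmat" where
  "type_matrix l = (\<chi> i j.
     if pos i < l \<and> pos j < l \<and> (pos j = pos i + l div 2 \<or> pos i = pos j + l div 2) then 1 else 0)"


section \<open>The Siegel upper half space and the real modular group\<close>

definition siegel :: "(complex^'g^'g) set" where
  "siegel = {\<tau>. transpose \<tau> = \<tau> \<and> (\<forall>x::real^'g. x \<noteq> 0 \<longrightarrow> 0 < x \<bullet> (map_matrix Im \<tau> *v x))}"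

definition siegel_real :: "nat \<Rightarrow> ((complex, 'g::{finite,linorder}) sqmat) set" where
  "siegel_real l = {\<tau> \<in> siegel. 2 *\<^sub>R map_matrix Re \<tau> = map_matrix of_int (type_matrix l)}"

definition block_matrix ::
  "'a^'g^'g \<Rightarrow> 'a^'g^'g \<Rightarrow> 'a^'g^'g \<Rightarrow> 'a^'g^'g \<Rightarrow> 'a^('g+'g)^('g+'g)" where
  "block_matrix A B C D = (\<chi> p q. case p of
       Inl i \<Rightarrow> (case q of Inl j \<Rightarrow> A $ i $ j | Inr j \<Rightarrow> B $ i $ j)
     | Inr i \<Rightarrow> (case q of Inl j \<Rightarrow> C $ i $ j | Inr j \<Rightarrow> D $ i $ j))"

definition upper_left :: "'a^('g+'g)^('g+'g) \<Rightarrow> 'a^'g^'g" where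
  "upper_left G = (\<chi> i j. G $ Inl i $ Inl j)"

text \<open>
  The matrix \<open>(M - A M A\<^sup>T) / 2\<close>. The integer division is exact whenever \<open>M \<equiv> A M A\<^sup>T\<close> modulo 2, which
  is required of the elements of the real modular group.
\<close>

definition half_defect ::
  "nat \<Rightarrow> (int, 'g::{finite,linorder}) sqmat \<Rightarrow> (int, 'g) sqmat" where
  "half_defect l A =
     map_matrix (\<lambda>k. k div 2) (type_matrix l - A ** type_matrix l ** transpose A)"

definition real_modular_group ::
  "nat \<Rightarrow> (int, 'g::{finite,linorder} + 'g) sqmat set" where
  "real_modular_group l =
     {block_matrix A (half_defect l A ** matrix_inv (transpose A)) 0 (matrix_inv (transpose A)) | A.
        invertible A \<and>
        (\<forall>i j. [type_matrix l $ i $ j = (A ** type_matrix l ** transpose A) $ i $ j] (mod 2))}"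

definition modular_action ::
  "nat \<Rightarrow> (int, 'g::{finite,linorder} + 'g) sqmat \<Rightarrow> (complex, 'g) sqmat \<Rightarrow> (complex, 'g) sqmat" where
  "modular_action l G \<tau> = (let A = upper_left G in
     map_matrix of_int A ** \<tau> ** transpose (map_matrix of_int A) + map_matrix of_int (half_defect l A))"


section \<open>Theta constants\<close>

definition pair :: "'a::comm_semiring_1^'g \<Rightarrow> 'a^'g \<Rightarrow> 'a" where
  "pair x y = (\<Sum>i\<in>UNIV. x $ i * y $ i)"

definition map_vec :: "('a \<Rightarrow> 'b) \<Rightarrow> 'a^'g \<Rightarrow> 'b^'g" where
  "map_vec f x = (\<chi> i. f (x $ i))"

definition theta_const :: "int^'g \<Rightarrow> complex^'g^'g \<Rightarrow> complex" where
  "theta_const \<beta> \<tau> = (\<Sum>\<^sub>\<infinity>m::int^'g.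
     exp (of_real pi * \<i> * pair (map_vec of_int m) (\<tau> *v map_vec of_int m)
          + of_real pi * \<i> * of_int (pair \<beta> m)))"

text \<open>
  The group of residue classes modulo 2 of integer vectors is \<open>bit^'g\<close>, where \<open>bit\<close> is the field with
  two elements. The theta constant of a class is computed with its representative in \<open>{0, 1}\<close>;
  by \<open>theta_class_class2\<close> every other representative gives the same value.
\<close>

definition class2 :: "int^'g \<Rightarrow> bit^'g" where
  "class2 \<beta> = map_vec of_int \<beta>"

definition theta_class :: "bit^'g \<Rightarrow> complex^'g^'g \<Rightarrow> complex" where
  "theta_class b \<tau> = theta_const (map_vec of_bit b) \<tau>"

lemma exp_pi_i_cong:
  assumes "[k = k'] (mod (2::int))"
  shows "exp (z + of_real pi * \<i> * of_int k) = exp (z + of_real pi * \<i> * of_int k')"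
proof -
  obtain n where n: "k = k' + 2 * n"
    using assms by (metis cong_iff_lin cong_sym)
  have "exp (z + of_real pi * \<i> * of_int k)
      = exp (z + of_real pi * \<i> * of_int k' + of_int (2 * n) * (of_real pi * \<i>))"
    by (simp add: n algebra_simps)
  also have "\<dots> = exp (z + of_real pi * \<i> * of_int k')"
    by (subst exp_eq) (auto intro!: exI[of _ n])
  finally show ?thesis .
qed

lemma theta_const_cong:
  assumes "\<And>i. [\<beta> $ i = \<beta>' $ i] (mod 2)"
  shows "theta_const \<beta> \<tau> = theta_const \<beta>' \<tau>"
  unfolding theta_const_def pair_def[of \<beta>] pair_def[of \<beta>']
  by (intro infsum_cong exp_pi_i_cong cong_sum cong_mult assms cong_refl)

lemma theta_class_class2: "theta_class (class2 \<beta>) \<tau> = theta_const \<beta> \<tau>"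
proof -
  have "[of_bit (of_int k :: bit) = k] (mod 2)" for k :: int
    by (cases "even k") (auto elim!: evenE oddE simp: cong_def)
  then show ?thesis
    unfolding theta_class_def class2_def by (intro theta_const_cong) (simp add: map_vec_def)
qed

definition odd_classes :: "nat \<Rightarrow> (bit^'g::{finite,linorder}) set" where
  "odd_classes l = {class2 \<beta> | \<beta>.
     [pair \<beta> (type_matrix l *v \<beta>) = 2] (mod 4) \<and> (\<forall>i. l \<le> pos i \<longrightarrow> [\<beta> $ i = 0] (mod 2))}"

definition even_classes :: "nat \<Rightarrow> (bit^'g::{finite,linorder}) set" where
  "even_classes l = {class2 \<beta> | \<beta>.
     [pair \<beta> (type_matrix l *v \<beta>) = 0] (mod 4) \<and> (\<forall>i. l \<le> pos i \<longrightarrow> [\<beta> $ i = 0] (mod 2))}"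

definition equal_up_to_permutation :: "'i set \<Rightarrow> ('i \<Rightarrow> 'a) \<Rightarrow> ('i \<Rightarrow> 'a) \<Rightarrow> bool" where
  "equal_up_to_permutation I u v \<longleftrightarrow> (\<exists>p. bij_betw p I I \<and> (\<forall>i\<in>I. u i = v (p i)))"


section \<open>Complex tori and their maps\<close>

text \<open>
  A point of the torus \<open>\<complex>\<^sup>g / L\<close> is a coset \<open>z +o L\<close>. The sum of two points is the sum of
  sets and the neutral element is the coset \<open>L\<close>.
\<close>

definition lattice :: "'v::euclidean_space set \<Rightarrow> bool" where
  "lattice L \<longleftrightarrow> 0 \<in> L \<and> (\<forall>x\<in>L. \<forall>y\<in>L. x - y \<in> L) \<and>
     (\<exists>e>0. \<forall>x\<in>L. x \<noteq> 0 \<longrightarrow> e \<le> norm x) \<and> span L = UNIV"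

definition torus :: "'v::ab_group_add set \<Rightarrow> 'v set set" where
  "torus L = range (\<lambda>z. z +o L)"

definition vcnj :: "complex^'g \<Rightarrow> complex^'g" where
  "vcnj = map_vec cnj"

definition holomorphic_map_on :: "(complex^'g) set \<Rightarrow> (complex^'g \<Rightarrow> complex^'h) \<Rightarrow> bool" where
  "holomorphic_map_on U F \<longleftrightarrow>
     (\<forall>z\<in>U. \<exists>D. (F has_derivative D) (at z) \<and> (\<forall>c x. D (c *s x) = c *s D x))"

text \<open>
  The local inverses of the projection \<open>\<complex>\<^sup>g \<longrightarrow> \<complex>\<^sup>g / L\<close> are the charts of the torus, so a
  map of tori is (anti-)holomorphic if it is locally induced by (anti-)holomorphic maps of open sets.
\<close>

definition torus_holomorphic ::
  "(complex^'g) set \<Rightarrow> (complex^'h) set \<Rightarrow> ((complex^'g) set \<Rightarrow> (complex^'h) set) \<Rightarrow> bool" where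
  "torus_holomorphic L L' f \<longleftrightarrow>
     (\<forall>p. \<exists>U F. open U \<and> p \<in> U \<and> holomorphic_map_on U F \<and> (\<forall>z\<in>U. f (z +o L) = F z +o L'))"

definition torus_antiholomorphic ::
  "(complex^'g) set \<Rightarrow> (complex^'h) set \<Rightarrow> ((complex^'g) set \<Rightarrow> (complex^'h) set) \<Rightarrow> bool" where
  "torus_antiholomorphic L L' f \<longleftrightarrow>
     (\<forall>p. \<exists>U F. open U \<and> p \<in> U \<and> holomorphic_map_on U (\<lambda>z. vcnj (F z)) \<and>
        (\<forall>z\<in>U. f (z +o L) = F z +o L'))"

text \<open>
  \<open>H\<^sub>1(\<complex>\<^sup>g / L, \<int>)\<close> is identified with \<open>L\<close>: the class of \<open>c \<in> L\<close> is that of the loop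
  \<open>t \<mapsto> [t c]\<close>, and the class of any loop is the difference of the endpoints of a lift to \<open>\<complex>\<^sup>g\<close>.
\<close>

definition H1_map ::
  "'v::euclidean_space set \<Rightarrow> 'w::euclidean_space set \<Rightarrow> ('v set \<Rightarrow> 'w set) \<Rightarrow> 'v \<Rightarrow> 'w" where
  "H1_map L L' f c = (THE d. \<exists>\<gamma>. path \<gamma> \<and> (\<forall>t\<in>{0..1}. \<gamma> t +o L' = f ((t *\<^sub>R c) +o L)) \<and>
     d = pathfinish \<gamma> - pathstart \<gamma>)"


section \<open>Real principally polarized abelian varieties\<close>

text \<open>
  The polarization is the alternating form \<open>E\<close> on \<open>H\<^sub>1(X, \<int>) = L\<close>, extended to an
  \<open>\<real>\<close>-bilinear form on \<open>\<complex>\<^sup>g\<close>.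
  The sign in the positivity condition is the one for which the form \<open>E(e\<^sub>i, f\<^sub>j) = \<delta>\<^sub>i\<^sub>j\<close> in the
  basis of columns of \<open>[Id | \<tau>]\<close> is a polarization. A polarization is principal
  if \<open>L\<close> has a symplectic basis over \<open>\<int>\<close>.
\<close>

record 'v real_av =
  periods :: "'v set"
  form :: "'v \<Rightarrow> 'v \<Rightarrow> real"
  invol :: "'v set \<Rightarrow> 'v set"

definition principal_polarization ::
  "(complex^'g) set \<Rightarrow> (complex^'g \<Rightarrow> complex^'g \<Rightarrow> real) \<Rightarrow> bool" where
  "principal_polarization L E \<longleftrightarrow>
     bilinear E \<and> (\<forall>x. E x x = 0) \<and>
     (\<forall>x\<in>L. \<forall>y\<in>L. E x y \<in> \<int>) \<and>
     (\<forall>x y. E (\<i> *s x) (\<i> *s y) = E x y) \<and>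
     (\<forall>x. x \<noteq> 0 \<longrightarrow> 0 < E x (\<i> *s x)) \<and>
     (\<exists>u v :: 'g \<Rightarrow> complex^'g.
        L = {\<Sum>i\<in>UNIV. real_of_int (m $ i) *\<^sub>R u i + real_of_int (n $ i) *\<^sub>R v i | m n. True} \<and>
        (\<forall>i j. E (u i) (u j) = 0 \<and> E (v i) (v j) = 0 \<and> E (u i) (v j) = (if i = j then 1 else 0)))"

definition real_ppav :: "(complex^'g) real_av \<Rightarrow> bool" where
  "real_ppav X \<longleftrightarrow> (let L = periods X; E = form X; S = invol X in
     lattice L \<and> principal_polarization L E \<and>
     S ` torus L \<subseteq> torus L \<and> (\<forall>x\<in>torus L. S (S x) = x) \<and>
     torus_antiholomorphic L L S \<and> S L = L \<and>
     (\<forall>c\<in>L. \<forall>d\<in>L. E (H1_map L L S c) (H1_map L L S d) = - E c d))"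

definition ppav_isomorphism ::
  "(complex^'g) real_av \<Rightarrow> (complex^'g) real_av \<Rightarrow> ((complex^'g) set \<Rightarrow> (complex^'g) set) \<Rightarrow> bool" where
  "ppav_isomorphism X Y f \<longleftrightarrow> (let L = periods X; L' = periods Y in
     bij_betw f (torus L) (torus L') \<and>
     torus_holomorphic L L' f \<and> torus_holomorphic L' L (inv_into (torus L) f) \<and>
     (\<forall>x\<in>torus L. \<forall>y\<in>torus L. f (x + y) = f x + f y) \<and>
     (\<forall>c\<in>L. \<forall>d\<in>L. form Y (H1_map L L' f c) (H1_map L L' f d) = form X c d))"

definition real_isomorphic :: "(complex^'g) real_av \<Rightarrow> (complex^'g) real_av \<Rightarrow> bool" where
  "real_isomorphic X Y \<longleftrightarrow> real_ppav X \<and> real_ppav Y \<and>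
     (\<exists>f. ppav_isomorphism X Y f \<and> (\<forall>x\<in>torus (periods X). f (invol X x) = invol Y (f x)))"


section \<open>The real abelian variety of a period matrix\<close>

definition period_map :: "complex^'g^'g \<Rightarrow> (real^'g) \<times> (real^'g) \<Rightarrow> complex^'g" where
  "period_map \<tau> = (\<lambda>(a, b). map_vec of_real a + \<tau> *v map_vec of_real b)"

definition period_lattice :: "complex^'g^'g \<Rightarrow> (complex^'g) set" where
  "period_lattice \<tau> = {map_vec of_int m + \<tau> *v map_vec of_int n | m n :: int^'g. True}"

text \<open>
  The real coordinates of \<open>z\<close> in the basis of columns of \<open>[Id | \<tau>]\<close> are \<open>inv (period_map \<tau>) z\<close>.
\<close>

definition standard_form :: "complex^'g^'g \<Rightarrow> complex^'g \<Rightarrow> complex^'g \<Rightarrow> real" where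
  "standard_form \<tau> z w = (let (a, b) = inv (period_map \<tau>) z; (a', b') = inv (period_map \<tau>) w
     in a \<bullet> b' - b \<bullet> a')"

text \<open>
  Conjugating every element of the coset \<open>z + L\<close> gives the coset of the conjugate of \<open>z\<close> if \<open>L\<close> is
  stable under conjugation, as the lattice of every \<open>\<tau> \<in> siegel_real l\<close> is.
\<close>

definition S_conj :: "(complex^'g) set \<Rightarrow> (complex^'g) set" where
  "S_conj x = vcnj ` x"

definition real_av_of :: "complex^'g^'g \<Rightarrow> (complex^'g) real_av" where
  "real_av_of \<tau> =
     \<lparr>periods = period_lattice \<tau>, form = standard_form \<tau>, invol = S_conj\<rparr>"


section \<open>The objects \<open>real_av_of \<tau>\<close> are real principally polarized abelian varieties\<close>

lemma real_ppav_real_av_of_siegel: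
  fixes \<tau> :: "complex^'g^'g"
  assumes "\<tau> \<in> siegel" and "2 *\<^sub>R map_matrix Re \<tau> = map_matrix of_int N"
  shows "real_ppav (real_av_of \<tau>)"
proof -
  define X where "X = map_matrix Re \<tau>"
  define Y where "Y = map_matrix Im \<tau>"
  define W where "W = matrix_inv Y"
  define P where "P = period_map \<tau>"
  define L where "L = period_lattice \<tau>"
  define re where "re = (map_vec Re :: complex^'g \<Rightarrow> real^'g)"
  define im where "im = (map_vec Im :: complex^'g \<Rightarrow> real^'g)"
  have sym: "transpose \<tau> = \<tau>" and pd: "\<And>x. x \<noteq> 0 \<Longrightarrow> 0 < x \<bullet> (Y *v x)"
    and reM: "2 *\<^sub>R X = map_matrix of_int N"
    using assms by (auto simp: siegel_def X_def Y_def)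
  have nth_sym: "\<tau> $ i $ j = \<tau> $ j $ i" for i j
    using sym by (metis transpose_def vec_lambda_beta)
  have symX: "transpose X = X" and symY: "transpose Y = Y"
    unfolding X_def Y_def transpose_def by (simp_all add: vec_eq_iff nth_sym)
  have "invertible Y"
    unfolding invertible_left_inverse matrix_left_invertible_ker
    using pd by (metis inner_zero_right less_irrefl)
  then have WY: "W ** Y = mat 1" and YW: "Y ** W = mat 1"
    unfolding W_def invertible_def matrix_inv_def by (metis (mono_tags, lifting) someI_ex)+
  have WY': "W *v (Y *v x) = x" and YW': "Y *v (W *v x) = x" for x
    by (simp_all add: matrix_vector_mul_assoc WY YW)
  have symXi: "(X *v x) \<bullet> y = x \<bullet> (X *v y)" and symYi: "(Y *v x) \<bullet> y = x \<bullet> (Y *v y)" for x y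
    by (metis dot_lmul_matrix vector_transpose_matrix symX)
       (metis dot_lmul_matrix vector_transpose_matrix symY)
  have symWi: "(W *v x) \<bullet> y = x \<bullet> (W *v y)" for x y
    using symYi[of "W *v x" "W *v y"] by (simp add: YW')
  have pdW: "0 \<le> (W *v x) \<bullet> x" and pdW': "x \<noteq> 0 \<Longrightarrow> 0 < (W *v x) \<bullet> x" for x
  proof -
    show "0 < (W *v x) \<bullet> x" if "x \<noteq> 0"
    proof -
      have "W *v x \<noteq> 0" using that YW'[of x] by auto
      from pd[OF this] show ?thesis by (simp add: YW')
    qed
    then show "0 \<le> (W *v x) \<bullet> x" by (cases "x = 0") (auto intro: less_imp_le)
  qed

  have eq_iff: "z = w \<longleftrightarrow> re z = re w \<and> im z = im w" for z w
    by (auto simp: re_def im_def map_vec_def vec_eq_iff complex_eq_iff)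
  have reP: "re (P (a, b)) = a + X *v b" and imP: "im (P (a, b)) = Y *v b" for a b
    by (simp_all add: re_def im_def P_def period_map_def map_vec_def X_def Y_def
          matrix_vector_mult_def vec_eq_iff)
  define Q where "Q = (\<lambda>z. (re z - X *v (W *v im z), W *v im z))"
  have PQ: "P (Q z) = z" for z
    by (subst eq_iff) (simp add: Q_def reP imP YW')
  have QP: "Q (P p) = p" for p
    by (cases p) (simp add: Q_def reP imP WY')
  have invP: "inv P = Q"
    using PQ QP by (intro inv_equality) auto
  have linre: "linear re" and linim: "linear im"
    by (auto intro!: linearI simp: re_def im_def map_vec_def vec_eq_iff)
  have linP: "linear P"
    by (auto intro!: linearI simp: P_def period_map_def map_vec_def vec_eq_iff
          matrix_vector_mult_def sum.distrib algebra_simps scaleR_sum_right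
          scaleR_conv_of_real[where 'a = complex] sum_distrib_left)
  have linQ: "linear Q"
    by (metis (mono_tags, lifting) PQ QP linP linearI linear_add linear_scale)
  define E where "E = standard_form \<tau>"
  have E: "E z w = re z \<bullet> (W *v im w) - (W *v im z) \<bullet> re w" for z w
    unfolding E_def standard_form_def P_def[symmetric] invP Q_def
    by (simp add: inner_diff_left inner_diff_right symXi)
  have EP: "E (P (a, b)) (P (a', b')) = a \<bullet> b' - b \<bullet> a'" for a b a' b'
    unfolding E_def standard_form_def P_def[symmetric] invP QP by simp
  have Lmem: "L = {P (map_vec of_int m, map_vec of_int n) | m n. True}"
    unfolding L_def period_lattice_def P_def period_map_def map_vec_def by simp
  have re_i: "re (\<i> *s z) = - im z" and im_i: "im (\<i> *s z) = re z" for z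
    by (simp_all add: re_def im_def map_vec_def vec_eq_iff)
  have re_c: "re (vcnj z) = re z" and im_c: "im (vcnj z) = - im z" for z
    by (simp_all add: re_def im_def vcnj_def map_vec_def vec_eq_iff)

  have mv_diff: "map_vec real_of_int (m - k) = map_vec of_int m - map_vec of_int k" for m k :: "int^'g"
    by (simp add: map_vec_def vec_eq_iff)

  have L0: "0 \<in> L"
    unfolding Lmem using linear_0[OF linP]
    by (auto intro!: exI[of _ "0 :: int^'g"] simp: map_vec_def zero_prod_def zero_vec_def)
  have Ld: "x - y \<in> L" if "x \<in> L" "y \<in> L" for x y
  proof -
    obtain m n m' n' :: "int^'g" where
      "x = P (map_vec of_int m, map_vec of_int n)" "y = P (map_vec of_int m', map_vec of_int n')"
      using \<open>x \<in> L\<close> \<open>y \<in> L\<close> unfolding Lmem by auto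
    then have "x - y = P (map_vec of_int (m - m'), map_vec of_int (n - n'))"
      by (simp add: linear_diff[OF linP, symmetric] mv_diff)
    then show ?thesis unfolding Lmem by blast
  qed
  have Ln: "- x \<in> L" if "x \<in> L" for x using Ld[OF L0 that] by simp
  have La: "x + y \<in> L" if "x \<in> L" "y \<in> L" for x y using Ld[OF that(1) Ln[OF that(2)]] by simp
  have int_norm: "1 \<le> norm (map_vec of_int m :: real^'g)" if "m \<noteq> 0" for m :: "int^'g"
  proof -
    obtain i where "m $ i \<noteq> 0" using \<open>m \<noteq> 0\<close> by (auto simp: vec_eq_iff)
    then have "1 \<le> \<bar>real_of_int (m $ i)\<bar>" by linarith
    also have "\<dots> \<le> norm (map_vec of_int m :: real^'g)"
      using component_le_norm_cart[of "map_vec of_int m :: real^'g" i] by (simp add: map_vec_def)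
    finally show ?thesis .
  qed
  obtain B where B: "B > 0" "\<And>z. norm (Q z) \<le> B * norm z"
    using linear_bounded_pos[OF linQ] by blast
  have Le: "1 / B \<le> norm x" if "x \<in> L" "x \<noteq> 0" for x
  proof -
    obtain m n :: "int^'g" where x: "x = P (map_vec of_int m, map_vec of_int n)"
      using \<open>x \<in> L\<close> unfolding Lmem by auto
    have "m \<noteq> 0 \<or> n \<noteq> 0"
      using \<open>x \<noteq> 0\<close> linear_0[OF linP] unfolding x
      by (auto simp: map_vec_def zero_prod_def zero_vec_def)
    then have "1 \<le> norm (Q x)"
      unfolding x QP using int_norm norm_fst_le norm_snd_le by (metis order_trans)
    also have "\<dots> \<le> B * norm x" by (rule B)
    finally show ?thesis using B(1) by (simp add: field_simps)
  qed
  have Leq: "L = {\<Sum>i\<in>UNIV. real_of_int (m $ i) *\<^sub>R P (axis i 1, 0)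
      + real_of_int (n $ i) *\<^sub>R P (0, axis i 1) | m n. True}"
  proof -
    have "P (map_vec of_int m, map_vec of_int n) = (\<Sum>i\<in>UNIV. real_of_int (m $ i) *\<^sub>R P (axis i 1, 0)
      + real_of_int (n $ i) *\<^sub>R P (0, axis i 1))" for m n :: "int^'g"
    proof -
      have "(map_vec of_int m, map_vec of_int n) = (\<Sum>i\<in>UNIV. real_of_int (m $ i) *\<^sub>R (axis i 1 :: real^'g, 0 :: real^'g)
          + real_of_int (n $ i) *\<^sub>R (0, axis i 1))"
        by (simp add: prod_eq_iff fst_sum snd_sum vec_eq_iff map_vec_def axis_def
            if_distrib[of "(*) _"] cong: if_cong)
      then show ?thesis
        by (simp only: linear_sum[OF linP] linear_add[OF linP] linear_scale[OF linP])
    qed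
    then show ?thesis unfolding Lmem by simp
  qed
  have "P (a, b) \<in> span L" for a b
  proof -
    have mv: "map_vec real_of_int (axis i 1) = axis i 1" "map_vec real_of_int (0 :: int^'g) = 0"
      for i :: 'g by (simp_all add: map_vec_def axis_def vec_eq_iff)
    have ax: "P (axis i 1, 0) \<in> L" "P (0, axis i 1) \<in> L" for i
      unfolding Lmem by (metis (mono_tags, lifting) mem_Collect_eq mv)+
    have "(a, b) = (\<Sum>i\<in>UNIV. (a $ i) *\<^sub>R (axis i 1 :: real^'g, 0 :: real^'g)
          + (b $ i) *\<^sub>R (0, axis i 1))"
      by (simp add: prod_eq_iff fst_sum snd_sum vec_eq_iff axis_def
            if_distrib[of "(*) _"] cong: if_cong)
    then have "P (a, b) = (\<Sum>i\<in>UNIV. (a $ i) *\<^sub>R P (axis i 1, 0) + (b $ i) *\<^sub>R P (0, axis i 1))"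
      by (simp only: linear_sum[OF linP] linear_add[OF linP] linear_scale[OF linP])
    then show ?thesis
      by (simp only:) (intro span_sum span_add span_scale span_base ax)
  qed
  then have "span L = UNIV" using PQ by (metis UNIV_eq_I surj_pair)
  then have lat: "lattice L"
    unfolding lattice_def using L0 Ld Le B(1) by (auto intro!: exI[of _ "1 / B"])

  have Eint: "E x y \<in> \<int>" if "x \<in> L" "y \<in> L" for x y
    using that unfolding Lmem by (auto simp: EP inner_vec_def map_vec_def intro!: Ints_diff Ints_sum Ints_mult)
  have bil: "bilinear E"
    unfolding bilinear_def E
    by (auto intro!: linearI simp: linear_add[OF linre] linear_add[OF linim] linear_scale[OF linre]
        linear_scale[OF linim] matrix_vector_right_distrib inner_add_left inner_add_right
        matrix_vector_mult_scaleR algebra_simps)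
  have Epos: "0 < E x (\<i> *s x)" if "x \<noteq> 0" for x
  proof -
    have "E x (\<i> *s x) = (W *v re x) \<bullet> re x + (W *v im x) \<bullet> im x"
      unfolding E re_i im_i by (simp add: symWi)
    moreover have "re x \<noteq> 0 \<or> im x \<noteq> 0"
      using that eq_iff[of x 0] linear_0[OF linre] linear_0[OF linim] by auto
    ultimately show ?thesis
      using pdW[of "re x"] pdW[of "im x"] pdW'[of "re x"] pdW'[of "im x"] by fastforce
  qed
  have Ealt: "E x x = 0" for x unfolding E by (simp add: inner_commute)
  have Ei: "E (\<i> *s x) (\<i> *s y) = E x y" for x y
    unfolding E re_i im_i by (simp add: symWi linear_neg[OF matrix_vector_mul_linear])
  have pol: "principal_polarization L E"
    unfolding principal_polarization_def
    by (intro conjI ballI allI impI bil Ealt Eint Ei Epos exI[of _ "\<lambda>i. P (axis i 1, 0)"]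
          exI[of _ "\<lambda>i. P (0, axis i 1)"] Leq)
       (auto simp: EP inner_axis_axis)

  have cinv: "vcnj (vcnj z) = z" for z by (simp add: vcnj_def map_vec_def)
  have cadd: "vcnj (z + w) = vcnj z + vcnj w" for z w by (simp add: vcnj_def map_vec_def vec_eq_iff)
  have Lc: "vcnj x \<in> L" if "x \<in> L" for x
  proof -
    obtain m n :: "int^'g" where x: "x = P (map_vec of_int m, map_vec of_int n)"
      using \<open>x \<in> L\<close> unfolding Lmem by auto
    have "2 *\<^sub>R (X *v map_vec of_int n) = map_vec of_int (N *v n)"
    proof -
      have "2 *\<^sub>R (X *v map_vec of_int n) = (2 *\<^sub>R X) *v map_vec of_int n"
        by (simp add: scaleR_matrix_vector_assoc)
      then show ?thesis
        unfolding reM by (simp add: matrix_vector_mult_def map_vec_def vec_eq_iff)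
    qed
    then have "map_vec of_int (N *v n) = X *v map_vec of_int n + X *v map_vec of_int n"
      by (metis scaleR_2)
    moreover have "map_vec real_of_int (m + k) = map_vec of_int m + map_vec of_int k"
       "map_vec real_of_int (- k) = - map_vec of_int k" for k :: "int^'g"
      by (simp_all add: map_vec_def vec_eq_iff)
    ultimately have "vcnj x = P (map_vec of_int (m + N *v n), map_vec of_int (- n))"
      by (subst eq_iff) (simp add: re_c im_c x reP imP linear_neg[OF matrix_vector_mul_linear])
    then show ?thesis unfolding Lmem by blast
  qed
  have Lc': "vcnj ` L = L" using Lc cinv by (metis image_subset_iff subsetI subset_antisym image_eqI)
  have Sc: "S_conj (z +o L) = vcnj z +o L" for z
  proof -
    have "S_conj (z +o L) = vcnj z +o (vcnj ` L)"
      unfolding S_conj_def elt_set_plus_def by (auto simp: cadd[symmetric])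
    then show ?thesis by (simp only: Lc')
  qed
  have coset: "z - w \<in> L" if "z +o L = w +o L" for z w
  proof -
    have "z \<in> w +o L" using that L0 by (metis add.right_neutral set_plus_intro2)
    then show ?thesis by (auto simp: elt_set_plus_def)
  qed
  have blc: "bounded_linear (vcnj :: complex^'g \<Rightarrow> complex^'g)"
    by (intro linear_conv_bounded_linear[THEN iffD1] linearI) (simp_all add: vcnj_def map_vec_def vec_eq_iff)
  have ah: "torus_antiholomorphic L L S_conj"
    unfolding torus_antiholomorphic_def holomorphic_map_on_def
    by (intro allI exI[of _ UNIV] exI[of _ vcnj]) (auto simp: Sc cinv intro!: exI[of _ "\<lambda>x. x"])
  have H1: "H1_map L L S_conj c = vcnj c" for c
    unfolding H1_map_def
  proof (rule the_equality)
    have csc: "vcnj (t *\<^sub>R c) = t *\<^sub>R vcnj c" for t by (rule linear_scale[OF bounded_linear.linear[OF blc]])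
    show "\<exists>\<gamma>. path \<gamma> \<and> (\<forall>t\<in>{0..1}. \<gamma> t +o L = S_conj ((t *\<^sub>R c) +o L)) \<and>
        vcnj c = pathfinish \<gamma> - pathstart \<gamma>"
      by (intro exI[of _ "\<lambda>t. t *\<^sub>R vcnj c"])
         (auto simp: Sc csc path_def pathfinish_def pathstart_def intro!: continuous_intros)
    fix d assume "\<exists>\<gamma>. path \<gamma> \<and> (\<forall>t\<in>{0..1}. \<gamma> t +o L = S_conj ((t *\<^sub>R c) +o L)) \<and>
        d = pathfinish \<gamma> - pathstart \<gamma>"
    then obtain \<gamma> where g: "path \<gamma>" "\<And>t. t \<in> {0..1} \<Longrightarrow> \<gamma> t +o L = (t *\<^sub>R vcnj c) +o L"
      "d = \<gamma> 1 - \<gamma> 0"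
      by (auto simp: Sc csc pathfinish_def pathstart_def)
    define \<delta> where "\<delta> t = \<gamma> t - t *\<^sub>R vcnj c" for t
    have "continuous_on {0..1} \<delta>"
      using g(1) unfolding \<delta>_def path_def by (intro continuous_intros)
    then have con: "connected (\<delta> ` {0..1})" by (intro connected_continuous_image) auto
    have sub: "\<delta> ` {0..1} \<subseteq> L" using coset[OF g(2)] by (auto simp: \<delta>_def)
    have "\<delta> 1 = \<delta> 0"
    proof (rule ccontr)
      assume ne: "\<delta> 1 \<noteq> \<delta> 0"
      define e where "e = 1 / (2 * B)"
      have far: "x \<notin> cball (\<delta> 0) e" if "x \<in> \<delta> ` {0..1}" "x \<noteq> \<delta> 0" for x
      proof -
        have "x - \<delta> 0 \<in> L" using sub that by (intro Ld) auto
        then have "1 / B \<le> norm (x - \<delta> 0)" using that by (intro Le) auto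
        moreover have "e < 1 / B" using B(1) by (simp add: e_def field_simps)
        ultimately show ?thesis by (simp add: dist_norm norm_minus_commute)
      qed
      have "e > 0" using B(1) by (simp add: e_def)
      then have cov: "x \<in> ball (\<delta> 0) e \<union> - cball (\<delta> 0) e" if "x \<in> \<delta> ` {0..1}" for x
        using far[OF that] by (cases "x = \<delta> 0") auto
      have "ball (\<delta> 0) e \<inter> \<delta> ` {0..1} = {} \<or> - cball (\<delta> 0) e \<inter> \<delta> ` {0..1} = {}"
      proof (rule connectedD[OF con])
        show "\<delta> ` {0..1} \<subseteq> ball (\<delta> 0) e \<union> - cball (\<delta> 0) e" using cov by blast
      qed (auto simp: open_Compl)
      moreover have "\<delta> 0 \<in> ball (\<delta> 0) e \<inter> \<delta> ` {0..1}" using \<open>e > 0\<close> by simp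
      moreover have "\<delta> 1 \<in> - cball (\<delta> 0) e \<inter> \<delta> ` {0..1}" using far[of "\<delta> 1"] ne by auto
      ultimately show False by blast
    qed
    then show "d = vcnj c" using g(3) by (simp add: \<delta>_def algebra_simps)
  qed
  have Ec: "E (vcnj c) (vcnj d) = - E c d" for c d
    unfolding E re_c im_c by (simp add: linear_neg[OF matrix_vector_mul_linear])
  show ?thesis
    unfolding real_ppav_def real_av_of_def Let_def real_av.select_convs
      L_def[symmetric] E_def[symmetric] H1
    using lat pol ah Lc' S_conj_def[of L]
    by (auto simp: torus_def Sc cinv Ec)
qed

lemma real_ppav_real_av_of: "\<tau> \<in> siegel_real l \<Longrightarrow> real_ppav (real_av_of \<tau>)"
  unfolding siegel_real_def using real_ppav_real_av_of_siegel by blast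

end

theory Submission
  imports Defs
begin

text \<open>
  Substituting \<open>n = A\<^sup>T m\<close> in the theta series shows that the constant of \<open>\<beta>\<close> at
  \<open>A \<tau> A\<^sup>T + N\<close> is the constant of \<open>A\<^sup>-\<^sup>1 (\<beta> + d)\<close> at \<open>\<tau>\<close>, where \<open>d\<close> is the diagonal of \<open>N\<close>; no
  convergence is needed, since both sides are the same unordered sum. Modulo 2, \<open>A\<close> is an isometry
  of the form \<open>M\<close>, and \<open>d\<close> measures its failure to preserve the quadratic form \<open>q(\<beta>) = \<beta>\<^sup>T M \<beta> / 2\<close>:
  \<open>q(A\<^sup>T v) = q(v) + d v\<close>. Completing the square, \<open>q(A\<^sup>T v) = q(v + M d) + q(d)\<close>, and summing
  \<open>(-1)\<^sup>q\<close> over all vectors forces \<open>q(d) = 0\<close> because the Gauss sum does not vanish. Hence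
  \<open>\<beta> \<mapsto> A\<^sup>-\<^sup>1 (\<beta> + d)\<close> preserves \<open>q\<close>, that is, it permutes the odd and the even classes.

  An isomorphism of the real abelian varieties lifts to a complex linear map \<open>D\<close> of the covering
  spaces that commutes with conjugation. The real periods are \<open>\<int>\<^sup>g\<close>, so \<open>D\<close> has an integral
  matrix \<open>A\<close>, and compatibility with the polarizations determines the images of the columns of \<open>\<tau>\<close>
  up to \<open>\<int>\<^sup>g\<close>, which gives \<open>\<tau>' = A \<tau> A\<^sup>T + N\<close> with \<open>N\<close> integral.
\<close>

text \<open>The simplifier normally turns the field operations of \<open>bit\<close> into bitwise operations.\<close>

declare add_bit_eq_xor [simp del] mult_bit_eq_and [simp del]

section \<open>Integer matrices and the standard pairing\<close>

lemma pair_commute: "pair x y = pair y x"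
  by (simp add: pair_def mult.commute)

lemma pair_add_left: "pair (x + y) z = pair x z + pair y z"
  and pair_add_right: "pair x (y + z) = pair x y + pair x z"
  by (simp_all add: pair_def algebra_simps sum.distrib)

lemma pair_matrix_vector: "pair x (A *v y) = pair (transpose A *v x) y"
proof -
  have "pair x (A *v y) = (\<Sum>i\<in>UNIV. \<Sum>j\<in>UNIV. x $ i * (A $ i $ j * y $ j))"
    by (simp add: pair_def matrix_vector_mult_def sum_distrib_left)
  also have "\<dots> = pair (transpose A *v x) y"
    by (subst sum.swap)
       (simp add: pair_def matrix_vector_mult_def transpose_def sum_distrib_left sum_distrib_right ac_simps)
  finally show ?thesis .
qed

lemma pair_axis_right: "pair x (axis i 1) = x $ i"
  by (simp add: pair_def axis_def if_distrib[of "(*) _"] cong: if_cong)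

lemma pair_axis_left: "pair (axis i 1) x = x $ i"
  by (simp add: pair_commute[of "axis i 1"] pair_axis_right)

lemma map_vec_nth [simp]: "map_vec f x $ i = f (x $ i)"
  by (simp add: map_vec_def)

lemma map_vec_of_int_add:
  "map_vec of_int (x + y) = (map_vec of_int x + map_vec of_int y :: 'a::ring_1 ^ 'n)"
  by (simp add: vec_eq_iff)

lemma matrix_vector_axis: "(A *v axis i 1) $ k = A $ k $ i" for A :: "'a::comm_semiring_1 ^ 'n ^ 'm"
  by (simp add: matrix_vector_mult_def axis_def if_distrib[of "(*) _"] cong: if_cong)

lemma matrix_add_mult_distrib: "(A + B) ** C = A ** C + B ** C"
  for A B :: "'a::semiring_1 ^ 'n ^ 'm"
  by (simp add: vec_eq_iff matrix_matrix_mult_def distrib_right sum.distrib)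

lemma map_vec_of_int_zero: "map_vec of_int 0 = (0 :: 'a::ring_1 ^ 'n)"
  by (simp add: vec_eq_iff)

lemma map_vec_of_int_axis: "map_vec of_int (axis i 1) = (axis i 1 :: 'a::ring_1 ^ 'n)"
  by (simp add: vec_eq_iff axis_def)

lemma of_int_pair: "of_int (pair x y) = pair (map_vec of_int x) (map_vec of_int y :: 'a::comm_ring_1 ^ 'n)"
  by (simp add: pair_def)

lemma map_vec_of_int_matrix_vector:
  "map_vec of_int (A *v x) = (map_matrix of_int A *v map_vec of_int x :: 'a::comm_ring_1 ^ 'n)"
  by (simp add: vec_eq_iff matrix_vector_mult_def)

lemma map_matrix_of_int_mult:
  "map_matrix of_int (A ** B) = (map_matrix of_int A ** map_matrix of_int B :: 'a::comm_ring_1 ^ 'm ^ 'n)"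
  by (simp add: vec_eq_iff matrix_matrix_mult_def)

lemma map_matrix_of_int_mat1: "map_matrix of_int (mat 1) = (mat 1 :: 'a::ring_1 ^ 'n ^ 'n)"
  by (simp add: vec_eq_iff mat_def)

lemma transpose_map_matrix: "transpose (map_matrix f A) = map_matrix f (transpose A)"
  by (simp add: vec_eq_iff transpose_def)

lemma transpose_nth [simp]: "transpose A $ i $ j = A $ j $ i"
  by (simp add: transpose_def)

lemma invertible_matrix_inv:
  assumes "invertible (A :: 'a::semiring_1 ^ 'n ^ 'n)"
  shows "A ** matrix_inv A = mat 1" "matrix_inv A ** A = mat 1"
  using assms unfolding invertible_def matrix_inv_def by (metis (mono_tags, lifting) someI_ex)+

lemma transpose_mat1: "transpose (mat 1) = mat 1"
  by (simp add: vec_eq_iff mat_def transpose_def eq_commute)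

section \<open>The matrix of a type as a permutation of indices\<close>

lemma pos_less_iff: "pos (i::'g::{finite,linorder}) < pos j \<longleftrightarrow> i < j"
proof
  have mono: "pos i < pos j" if "i < j" for i j :: 'g
    unfolding pos_def using that by (intro psubset_card_mono) auto
  then show "i < j" if "pos i < pos j"
    using that by (metis less_asym linorder_less_linear)
  show "i < j \<Longrightarrow> pos i < pos j" by (rule mono)
qed

lemma pos_inject: "pos (i::'g::{finite,linorder}) = pos j \<longleftrightarrow> i = j"
  by (metis less_irrefl linorder_less_linear pos_less_iff)

lemma pos_surj:
  assumes "n < CARD('g)"
  obtains i :: "'g::{finite,linorder}" where "pos i = n"
proof -
  have "pos i < CARD('g)" for i :: 'g
    unfolding pos_def by (intro psubset_card_mono) auto
  then have "range (pos :: 'g \<Rightarrow> nat) \<subseteq> {..<CARD('g)}" by auto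
  moreover have "card (range (pos :: 'g \<Rightarrow> nat)) = CARD('g)"
    by (intro card_image injI) (simp add: pos_inject)
  ultimately have "range (pos :: 'g \<Rightarrow> nat) = {..<CARD('g)}"
    by (intro card_subset_eq) auto
  then show ?thesis using assms that by (metis imageE lessThan_iff)
qed

lemma transpose_type_matrix: "transpose (type_matrix l) = type_matrix l"
  by (auto simp: vec_eq_iff type_matrix_def)

lemma type_matrix_diagonal: "even l \<Longrightarrow> type_matrix l $ i $ i = 0"
  by (auto simp: type_matrix_def elim!: evenE)

lemma type_matrix_0_or_1: "type_matrix l $ i $ j = 0 \<or> type_matrix l $ i $ j = 1"
  by (simp add: type_matrix_def)

text \<open>For even \<open>l\<close> the first \<open>l\<close> positions form two halves of equal
  size and each index has a single partner at distance \<open>l div 2\<close>, so the matrix is that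
  of an involution there.\<close>

lemma type_matrix_row:
  assumes "even l" "type_matrix l $ i $ j = 1"
  shows "type_matrix l $ i $ k = (if k = j then 1 else 0)"
proof -
  have "k = j" if "type_matrix l $ i $ k = 1"
  proof -
    have "pos k = pos j"
      using assms that by (auto simp: type_matrix_def split: if_splits elim!: evenE)
    then show ?thesis by (simp add: pos_inject)
  qed
  then show ?thesis using assms(2) type_matrix_0_or_1[of l i k] by metis
qed

lemma type_matrix_row_ex:
  fixes i :: "'g::{finite,linorder}"
  assumes "even l" "l \<le> CARD('g)" "pos i < l"
  obtains j where "type_matrix l $ i $ j = 1"
proof -
  define n where "n = (if pos i < l div 2 then pos i + l div 2 else pos i - l div 2)"
  have n: "n < l" "n = pos i + l div 2 \<or> pos i = n + l div 2"
    using assms unfolding n_def by (auto elim!: evenE)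
  then obtain j :: 'g where "pos j = n" using assms(2) by (metis pos_surj order_less_le_trans)
  then show ?thesis using n assms that[of j] by (simp add: type_matrix_def)
qed

lemma type_matrix_row_outside: "l \<le> pos i \<Longrightarrow> type_matrix l $ i $ j = 0"
  by (simp add: type_matrix_def)

text \<open>The image of \<open>M\<close> in any commutative ring, so that the same facts serve over
  \<open>int\<close> and over \<open>bit\<close>.\<close>

definition type_mat :: "nat \<Rightarrow> ('a::comm_ring_1, 'g::{finite,linorder}) sqmat" where
  "type_mat l = map_matrix of_int (type_matrix l)"

lemma type_mat_mult_nth:
  assumes "even l" "type_matrix l $ i $ j = 1"
  shows "(type_mat l *v x) $ i = x $ j"
  by (simp add: matrix_vector_mult_def type_mat_def type_matrix_row[OF assms]
      if_distrib[of of_int] if_distrib[of "\<lambda>a. a * _"] cong: if_cong)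

lemma type_mat_mult_outside: "l \<le> pos i \<Longrightarrow> (type_mat l *v x) $ i = 0"
  by (simp add: matrix_vector_mult_def type_mat_def type_matrix_row_outside)

lemma type_matrix_sym: "type_matrix l $ i $ j = type_matrix l $ j $ i"
  using transpose_type_matrix by (metis transpose_nth)

lemma type_mat_involution:
  fixes x :: "'a::comm_ring_1 ^ 'g::{finite,linorder}"
  assumes "even l" "l \<le> CARD('g)" "\<And>i. l \<le> pos i \<Longrightarrow> x $ i = 0"
  shows "type_mat l *v (type_mat l *v x) = x"
  unfolding vec_eq_iff
proof
  fix i
  show "(type_mat l *v (type_mat l *v x)) $ i = x $ i"
  proof (cases "pos i < l")
    case True
    then obtain j where "type_matrix l $ i $ j = 1" using assms type_matrix_row_ex by blast
    then show ?thesis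
      using assms(1) by (simp add: type_mat_mult_nth[of l i j] type_mat_mult_nth[of l j i] type_matrix_sym)
  next
    case False
    then show ?thesis using assms(3) by (simp add: type_mat_mult_outside)
  qed
qed

section \<open>The quadratic form of a type\<close>

text \<open>Over \<open>bit\<close> the value \<open>x^T M x\<close> cannot be halved. For even
  \<open>l\<close> the strictly upper triangle of \<open>M\<close> gives the half \<open>q\<close>
  directly, in any characteristic, with polar form \<open>M\<close>.\<close>

definition upper_part :: "nat \<Rightarrow> ('a::comm_ring_1, 'g::{finite,linorder}) sqmat" where
  "upper_part l = (\<chi> i j. if i < j then type_mat l $ i $ j else 0)"

definition type_form :: "nat \<Rightarrow> 'a::comm_ring_1 ^ 'g::{finite,linorder} \<Rightarrow> 'a" where
  "type_form l x = pair x (upper_part l *v x)"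

lemma type_mat_upper_part: "even l \<Longrightarrow> type_mat l = upper_part l + transpose (upper_part l)"
  by (auto simp: vec_eq_iff upper_part_def type_mat_def type_matrix_diagonal not_less order_le_less
      type_matrix_sym)

lemma type_form_add:
  assumes "even l"
  shows "type_form l (x + y) = type_form l x + type_form l y + pair x (type_mat l *v y)"
proof -
  have "pair y (upper_part l *v x) = pair x (transpose (upper_part l) *v y)"
    by (metis pair_commute pair_matrix_vector)
  then show ?thesis
    unfolding type_form_def type_mat_upper_part[OF assms] matrix_vector_mult_add_rdistrib
      matrix_vector_right_distrib pair_add_right pair_add_left by (simp add: add_ac)
qed

lemma pair_transpose_self: "pair x (transpose A *v x) = pair x (A *v x)"
  by (metis pair_commute pair_matrix_vector)

lemma pair_type_mat_self:
  assumes "even l"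
  shows "pair x (type_mat l *v x) = 2 * type_form l x"
  unfolding type_form_def type_mat_upper_part[OF assms] matrix_vector_mult_add_rdistrib
    pair_add_right pair_transpose_self by simp

lemma of_int_type_form: "of_int (type_form l x) = type_form l (map_vec of_int x)"
  by (simp add: type_form_def pair_def matrix_vector_mult_def upper_part_def type_mat_def
      if_distrib[of of_int] cong: if_cong)

lemma type_form_axis: "even l \<Longrightarrow> type_form l (axis i 1) = 0"
  unfolding type_form_def pair_axis_left
  by (simp add: matrix_vector_mult_def upper_part_def axis_def if_distrib[of "(*) _"] cong: if_cong)

text \<open>\<open>M\<close> exchanges the two coordinates in each product \<open>x_i x_j\<close>
  that occurs in the form.\<close>

lemma type_form_type_mat:
  assumes "even l"
  shows "type_form l (type_mat l *v x) = type_form l x"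
proof -
  have "(type_mat l *v x) $ i * (upper_part l $ i $ j * (type_mat l *v x) $ j)
      = x $ j * (upper_part l $ i $ j * x $ i)" for i j
  proof (cases "type_matrix l $ i $ j = 1")
    case True
    moreover have "type_matrix l $ j $ i = 1" using True type_matrix_sym by metis
    ultimately show ?thesis using assms by (simp add: type_mat_mult_nth)
  next
    case False
    then show ?thesis using type_matrix_0_or_1[of l i j] by (simp add: upper_part_def type_mat_def)
  qed
  then show ?thesis
    by (simp add: type_form_def pair_def matrix_vector_mult_def[of "upper_part l"] sum_distrib_left ac_simps)
qed

section \<open>Vectors over the field with two elements\<close>

instance bit :: finite
proof
  have *: "(UNIV :: bit set) = {0, 1}" using bit.nchotomy by blast
  show "finite (UNIV :: bit set)" unfolding * by simp
qed

lemma bit_add_self: "x + x = (0::bit)"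
  by (cases "x = 0") auto

lemma bit_vec_add_self: "x + x = (0 :: bit ^ 'n)"
  by (simp add: vec_eq_iff bit_add_self)

lemma of_int_bit: "(of_int k :: bit) = (if even k then 0 else 1)"
  by (cases "even k") (auto elim!: evenE oddE)

lemma of_int_bit_eq_iff: "(of_int k :: bit) = of_int m \<longleftrightarrow> [k = m] (mod 2)"
  by (auto simp: of_int_bit cong_def even_iff_mod_2_eq_zero odd_iff_mod_2_eq_one)

lemma of_int_of_bit: "(of_int (of_bit b) :: bit) = b"
  by (cases "b = 0") auto

lemma class2_surj: "class2 (map_vec of_bit b) = b"
  by (simp add: class2_def vec_eq_iff of_int_of_bit)

definition supported :: "nat \<Rightarrow> 'a::zero ^ 'g::{finite,linorder} \<Rightarrow> bool" where
  "supported l x \<longleftrightarrow> (\<forall>i. l \<le> pos i \<longrightarrow> x $ i = 0)"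

lemma supported_type_mat: "supported l (type_mat l *v x)"
  by (simp add: supported_def type_mat_mult_outside)

lemma type_mat_int: "type_mat l = type_matrix l"
  by (simp add: type_mat_def vec_eq_iff)

text \<open>Since \<open>\<beta>^T M \<beta> = 2 q(\<beta>)\<close>, a congruence modulo 4 with even
  right-hand side is a condition on \<open>q\<close> modulo 2 and descends to vectors over
  \<open>bit\<close>.\<close>

lemma residue_classes:
  assumes "even l" "even k"
  shows "{class2 \<beta> | \<beta> :: (int, 'g::{finite,linorder}) vec.
     [pair \<beta> (type_matrix l *v \<beta>) = k] (mod 4) \<and> (\<forall>i. l \<le> pos i \<longrightarrow> [\<beta> $ i = 0] (mod 2))} =
    {b. type_form l b = of_int (k div 2) \<and> supported l b}"
    (is "{class2 \<beta> | \<beta>. ?P \<beta>} = {b. ?Q b}")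
proof -
  have *: "?P \<beta> \<longleftrightarrow> ?Q (class2 \<beta>)" for \<beta> :: "(int, 'g::{finite,linorder}) vec"
  proof -
    obtain m where "k = 2 * m" using assms(2) by (elim evenE)
    moreover have "[2 * x = 2 * m] (mod 4) \<longleftrightarrow> [x = m] (mod 2)" for x :: int
      unfolding cong_iff_dvd_diff by presburger
    ultimately have "[pair \<beta> (type_matrix l *v \<beta>) = k] (mod 4) \<longleftrightarrow> type_form l (class2 \<beta>) = of_int (k div 2)"
      using pair_type_mat_self[OF assms(1), of \<beta>]
      by (simp add: type_mat_int class2_def flip: of_int_type_form of_int_bit_eq_iff)
    moreover have "[\<beta> $ i = 0] (mod 2) \<longleftrightarrow> class2 \<beta> $ i = 0" for i
      using of_int_bit_eq_iff[of "\<beta> $ i" 0] by (simp add: class2_def)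
    ultimately show ?thesis by (simp add: supported_def)
  qed
  show ?thesis unfolding * set_eq_iff mem_Collect_eq using class2_surj by metis
qed

lemma odd_classes_eq: "even l \<Longrightarrow> odd_classes l = {b. type_form l b = 1 \<and> supported l b}"
  and even_classes_eq: "even l \<Longrightarrow> even_classes l = {b. type_form l b = 0 \<and> supported l b}"
  unfolding odd_classes_def even_classes_def by (simp_all add: residue_classes)

section \<open>The Gauss sum of the quadratic form\<close>

text \<open>The nontrivial character of \<open>bit\<close>, with values in \<open>int\<close> so
  that its sums are taken in characteristic 0.\<close>

definition bit_sign :: "bit \<Rightarrow> int" where
  "bit_sign b = (if b = 0 then 1 else - 1)"

lemma bit_sign_add: "bit_sign (a + b) = bit_sign a * bit_sign b"
  by (cases "a = 0"; cases "b = 0") (auto simp: bit_sign_def)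

lemma bit_sign_eq_1: "bit_sign b = 1 \<longleftrightarrow> b = 0"
  by (simp add: bit_sign_def)

text \<open>Orthogonality of characters: translation by a unit vector whose pairing with
  \<open>w\<close> is 1 permutes the vectors and reverses every sign.\<close>

lemma sum_bit_sign_pair: "(\<Sum>u\<in>UNIV. bit_sign (pair u w)) = (if w = 0 then int CARD(bit ^ 'n) else 0)"
  for w :: "bit ^ 'n"
proof (cases "w = 0")
  case True
  then show ?thesis by (simp add: pair_def bit_sign_def)
next
  case False
  then obtain i where i: "w $ i = 1" by (metis bit_not_one_iff vec_eq_iff zero_index)
  have "(\<Sum>u\<in>UNIV. bit_sign (pair u w)) = (\<Sum>u\<in>UNIV. bit_sign (pair (axis i 1 + u) w))"
    by (rule sum.reindex_bij_witness[of _ "\<lambda>u. axis i 1 + u" "\<lambda>u. axis i 1 + u"])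
       (auto simp: bit_vec_add_self simp flip: add.assoc)
  also have "\<dots> = - (\<Sum>u\<in>UNIV. bit_sign (pair u w))"
    by (simp add: pair_add_left pair_axis_left i bit_sign_add sum_negf bit_sign_def[of 1])
  finally show ?thesis using False by simp
qed

text \<open>The square of the Gauss sum is the number of vectors times the size of the radical.\<close>

lemma gauss_sum_nonzero:
  assumes "even l"
  shows "(\<Sum>v\<in>UNIV. bit_sign (type_form l (v :: (bit, 'g::{finite,linorder}) vec))) \<noteq> 0"
proof -
  let ?q = "type_form l :: (bit, 'g) vec \<Rightarrow> bit"
  let ?S = "\<Sum>v\<in>UNIV. bit_sign (?q v)"
  \<comment> \<open>As \<open>q(w) = q(M w)\<close>, the vectors that survive the summation over
    \<open>u\<close> all carry the sign +1.\<close>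
  have radical: "?q w = 0" if "type_mat l *v w = 0" for w
    using type_form_type_mat[OF assms, of w] that by (simp add: type_form_def pair_def)
  have "?S * ?S = (\<Sum>u\<in>UNIV. \<Sum>v\<in>UNIV. bit_sign (?q u) * bit_sign (?q v))"
    by (simp add: sum_product)
  also have "\<dots> = (\<Sum>u\<in>UNIV. \<Sum>w\<in>UNIV. bit_sign (?q u) * bit_sign (?q (u + w)))"
  proof (rule sum.cong[OF refl])
    fix u
    show "(\<Sum>v\<in>UNIV. bit_sign (?q u) * bit_sign (?q v)) = (\<Sum>w\<in>UNIV. bit_sign (?q u) * bit_sign (?q (u + w)))"
      by (rule sum.reindex_bij_witness[of _ "\<lambda>w. u + w" "\<lambda>w. u + w"])
         (simp_all add: bit_vec_add_self flip: add.assoc)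
  qed
  \<comment> \<open>The two copies of \<open>q(u)\<close> cancel modulo 2, which leaves an exponent
    affine in \<open>u\<close>.\<close>
  also have "\<dots> = (\<Sum>u\<in>UNIV. \<Sum>w\<in>UNIV. bit_sign (?q w) * bit_sign (pair u (type_mat l *v w)))"
  proof -
    have "?q u + ?q (u + w) = ?q w + pair u (type_mat l *v w)" for u w
      using bit_add_self[of "?q u"] by (simp add: type_form_add[OF assms] flip: add.assoc)
    then show ?thesis by (simp flip: bit_sign_add)
  qed
  also have "\<dots> = (\<Sum>w\<in>UNIV. bit_sign (?q w) * (\<Sum>u\<in>UNIV. bit_sign (pair u (type_mat l *v w))))"
    by (subst sum.swap) (simp add: sum_distrib_left)
  also have "\<dots> = (\<Sum>w\<in>UNIV. if type_mat l *v w = (0 :: (bit, 'g) vec) then int CARD((bit, 'g) vec) else 0)"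
    unfolding sum_bit_sign_pair using radical by (intro sum.cong) (auto simp: bit_sign_def)
  also have "\<dots> > 0"
  proof -
    define N where "N = int CARD((bit, 'g) vec)"
    have "N > 0" unfolding N_def by (simp only: of_nat_0_less_iff zero_less_card_finite)
    then show ?thesis unfolding N_def[symmetric] by (intro sum_pos2[of _ 0]) auto
  qed
  finally show ?thesis by auto
qed

section \<open>Isometries of the bilinear form and the quadratic form\<close>

text \<open>Additive maps are already linear, the only scalars being 0 and 1.\<close>

lemma bit_additive_eq_pair:
  fixes f :: "bit ^ 'n \<Rightarrow> bit"
  assumes add: "\<And>u v. f (u + v) = f u + f v"
  shows "f v = pair (\<chi> i. f (axis i 1)) v"
proof -
  have zero: "f 0 = 0" using add[of 0 0] by simp
  have scale: "f (c *s axis i 1) = c * f (axis i 1)" for c i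
    by (cases "c = 0") (auto simp: zero)
  have "f (\<Sum>i\<in>S. v $ i *s axis i 1) = (\<Sum>i\<in>S. v $ i * f (axis i 1))" if "finite S" for S
    using that by induction (simp_all add: zero add scale)
  from this[of UNIV] show ?thesis
    by (simp add: basis_expansion pair_def mult.commute)
qed

text \<open>By symmetry the two cross terms are equal and cancel, so \<open>v^T N v\<close> is
  additive in \<open>v\<close> and determined by its values on unit vectors.\<close>

lemma bit_symmetric_form:
  fixes N :: "bit ^ 'n ^ 'n"
  assumes "transpose N = N"
  shows "pair v (N *v v) = pair (\<chi> i. N $ i $ i) v"
proof -
  have "pair (u + v) (N *v (u + v)) = pair u (N *v u) + pair v (N *v v)" for u v
  proof -
    have "pair u (N *v v) = pair v (N *v u)" by (metis assms pair_commute pair_matrix_vector)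
    then show ?thesis
      by (simp only: matrix_vector_right_distrib pair_add_left pair_add_right)
        (cases "pair v (N *v u) = 0"; simp)
  qed
  from bit_additive_eq_pair[OF this] show ?thesis
    by (simp add: pair_axis_left matrix_vector_axis)
qed

text \<open>The forms \<open>q(A^T v)\<close> and \<open>q(v)\<close> have the same polar form, so
  their difference is additive. Since \<open>q\<close> vanishes on unit vectors, its coefficients
  are the values of \<open>q\<close> on the rows of \<open>A\<close>.\<close>

lemma isometry_type_form:
  fixes A :: "(bit, 'g::{finite,linorder}) sqmat"
  assumes l: "even l" and A: "A ** type_mat l ** transpose A = type_mat l"
  shows "type_form l (transpose A *v v) = type_form l v + pair (\<chi> i. type_form l (row i A)) v"
proof -
  let ?q = "type_form l :: (bit, 'g) vec \<Rightarrow> bit"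
  define f where "f v = ?q (transpose A *v v) + ?q v" for v
  have iso: "pair (transpose A *v u) (type_mat l *v (transpose A *v v)) = pair u (type_mat l *v v)" for u v
    by (metis A matrix_vector_mul_assoc pair_matrix_vector)
  have "f (u + v) = f u + f v + (pair u (type_mat l *v v) + pair u (type_mat l *v v))" for u v
    by (simp only: f_def matrix_vector_right_distrib type_form_add[OF l] iso add_ac)
  then have add: "f (u + v) = f u + f v" for u v by (simp add: bit_add_self)
  have "f (axis i 1) = ?q (row i A)" for i
  proof -
    have "transpose A *v axis i 1 = row i A"
      by (simp add: vec_eq_iff matrix_vector_axis row_def del: transpose_matrix_vector)
    then show ?thesis by (simp add: f_def type_form_axis[OF l])
  qed
  then have "f v = pair (\<chi> i. ?q (row i A)) v"
    using bit_additive_eq_pair[of f v] add by simp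
  then show ?thesis
    using bit_add_self[of "?q v"] by (metis f_def add.assoc add.commute add.right_neutral)
qed

text \<open>On supported vectors \<open>M\<close> is its own inverse, and
  \<open>B M = M A^T\<close>, so \<open>B (b + d) = M A^T M (b + d)\<close>. As \<open>M\<close>
  preserves \<open>q\<close>, only the effect of \<open>A^T\<close> on \<open>q\<close> matters,
  which \<open>d\<close> describes.\<close>

lemma isometry_shift:
  fixes A B :: "(bit, 'g::{finite,linorder}) sqmat" and b :: "(bit, 'g::{finite,linorder}) vec"
  assumes l: "even l" "l \<le> CARD('g)"
    and A: "A ** type_mat l ** transpose A = type_mat l" and BA: "B ** A = mat 1"
    and d: "d = (\<chi> i. type_form l (row i A))" and b: "supported l b"
  shows "supported l (B *v (b + d))" and "type_form l (B *v (b + d)) = type_form l b"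
proof -
  let ?q = "type_form l :: (bit, 'g) vec \<Rightarrow> bit" and ?M = "type_mat l :: (bit, 'g) sqmat"
  have qA: "?q (transpose A *v v) = ?q v + pair d v" for v
    unfolding d by (rule isometry_type_form[OF l(1) A])
  have BM: "B *v (?M *v v) = ?M *v (transpose A *v v)" for v
    by (metis A BA matrix_mul_assoc matrix_mul_lid matrix_vector_mul_assoc)
  have inv: "?M *v (?M *v x) = x" if "supported l x" for x
    using that by (intro type_mat_involution[OF l]) (simp add: supported_def)
  \<comment> \<open>The unit vector \<open>e_i\<close> is in the radical:
    \<open>q(A^T e_i) = q(M A^T e_i) = q(B M e_i) = 0\<close>, whereas the defect formula gives
    \<open>q(e_i) + d_i = d_i\<close>.\<close>
  have "d $ i = 0" if i: "l \<le> pos i" for i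
  proof -
    have ax: "?M *v axis i 1 = 0"
      using i by (simp add: vec_eq_iff matrix_vector_axis type_mat_def
          type_matrix_sym[of l _ i] type_matrix_row_outside)
    have "?q (transpose A *v axis i 1) = ?q (B *v (?M *v axis i 1))"
      unfolding BM type_form_type_mat[OF l(1)] ..
    also have "\<dots> = 0" unfolding ax by (simp add: type_form_def pair_def)
    finally show ?thesis
      unfolding qA by (simp add: type_form_axis[OF l(1)] pair_axis_right)
  qed
  then have d': "supported l d" by (simp add: supported_def)
  let ?d = "?M *v d" and ?b = "?M *v b"
  have dd: "pair d v = pair v (?M *v ?d)" for v
    by (simp add: inv[OF d'] pair_commute)
  \<comment> \<open>Completing the square: \<open>d = M (M d)\<close>, so pairing with
    \<open>d\<close> is the polar form with \<open>M d\<close>.\<close>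
  have "?q (transpose A *v v) = ?q (v + ?d) + ?q ?d" for v
    unfolding qA dd type_form_add[OF l(1)] by (cases "?q ?d = 0") auto
  then have "bit_sign (?q (transpose A *v v)) = bit_sign (?q (v + ?d)) * bit_sign (?q ?d)" for v
    by (simp add: bit_sign_add)
  then have "(\<Sum>v\<in>UNIV. bit_sign (?q (transpose A *v v)))
      = (\<Sum>v\<in>UNIV. bit_sign (?q (v + ?d))) * bit_sign (?q ?d)"
    by (simp add: sum_distrib_right)
  moreover have "(\<Sum>v\<in>UNIV. bit_sign (?q (transpose A *v v))) = (\<Sum>v\<in>UNIV. bit_sign (?q v))"
  proof (rule sum.reindex_bij_witness[of _ "\<lambda>v. transpose B *v v" "\<lambda>v. transpose A *v v"])
    have "transpose A ** transpose B = mat 1"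
      by (metis BA matrix_transpose_mul transpose_mat1)
    then have "transpose B ** transpose A = mat 1" by (simp add: matrix_left_right_inverse)
    with \<open>transpose A ** transpose B = mat 1\<close>
    show "transpose B *v (transpose A *v v) = v" "transpose A *v (transpose B *v v) = v" for v
      by (simp_all add: matrix_vector_mul_assoc del: transpose_matrix_vector)
  qed auto
  moreover have "(\<Sum>v\<in>UNIV. bit_sign (?q (v + ?d))) = (\<Sum>v\<in>UNIV. bit_sign (?q v))"
    by (rule sum.reindex_bij_witness[of _ "\<lambda>v. v + ?d" "\<lambda>v. v + ?d"])
       (auto simp: bit_vec_add_self add.assoc)
  \<comment> \<open>Both substitutions are bijections, so the nonzero Gauss sum equals itself times
    the sign of \<open>q(M d)\<close>.\<close>
  ultimately have "bit_sign (?q ?d) = 1"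
    using gauss_sum_nonzero[OF l(1), where 'g = 'g] by auto
  then have qd: "?q d = 0" by (simp add: bit_sign_eq_1 type_form_type_mat[OF l(1)])
  have eq: "B *v (b + d) = ?M *v (transpose A *v (?b + ?d))"
    by (metis BM inv b d' matrix_vector_right_distrib)
  then show "supported l (B *v (b + d))" by (simp only: supported_type_mat)
  have "?q (B *v (b + d)) = ?q (?b + ?d) + pair d (?b + ?d)"
    unfolding eq type_form_type_mat[OF l(1)] qA ..
  also have "\<dots> = ?q b + (pair ?b (?M *v ?d) + pair ?b (?M *v ?d)) + pair ?d (?M *v ?d)"
    unfolding dd pair_add_left type_form_add[OF l(1)] type_form_type_mat[OF l(1)] qd
    by (simp add: add_ac)
  also have "\<dots> = ?q b"
    unfolding pair_type_mat_self[OF l(1)] type_form_type_mat[OF l(1)] qd by (simp add: bit_add_self)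
  finally show "?q (B *v (b + d)) = ?q b" .
qed

section \<open>Theta constants under integral changes of variables\<close>

lemma theta_const_transform:
  fixes A B N :: "int ^ 'g ^ 'g" and \<tau> :: "complex ^ 'g ^ 'g"
  assumes AB: "A ** B = mat 1" "B ** A = mat 1" and N: "transpose N = N"
  shows "theta_const \<beta> (map_matrix of_int A ** \<tau> ** transpose (map_matrix of_int A) + map_matrix of_int N)
    = theta_const (B *v (\<beta> + (\<chi> i. N $ i $ i))) \<tau>"
    (is "theta_const \<beta> ?\<tau>' = theta_const ?\<gamma> \<tau>")
proof -
  define e :: "int ^ 'g \<Rightarrow> complex ^ 'g" where "e = map_vec of_int"
  have BA': "transpose B *v (transpose A *v m) = m" "transpose A *v (transpose B *v m) = m" for m :: "int ^ 'g"
    by (metis AB matrix_transpose_mul transpose_mat1 matrix_vector_mul_assoc matrix_vector_mul_lid)+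
  have bij: "bij_betw (\<lambda>n. transpose B *v n) (UNIV :: (int ^ 'g) set) UNIV"
    by (rule bij_betw_byWitness[where f' = "\<lambda>m. transpose A *v m"])
       (simp_all only: BA', auto)
  have quad: "pair (e m) (?\<tau>' *v e m) = pair (e (transpose A *v m)) (\<tau> *v e (transpose A *v m)) + of_int (pair m (N *v m))" for m
    by (simp only: e_def map_vec_of_int_matrix_vector of_int_pair matrix_vector_mult_add_rdistrib
        pair_add_right transpose_map_matrix[symmetric] matrix_vector_mul_assoc[symmetric]
        pair_matrix_vector[of _ "map_matrix of_int A"])
  \<comment> \<open>Modulo 2 the form \<open>m^T N m\<close> is linear in \<open>m\<close>, so
    translating by \<open>N\<close> only adds its diagonal to the characteristic.\<close>
  have parity: "[pair m (N *v m) = pair (\<chi> i. N $ i $ i) m] (mod 2)" for m :: "int ^ 'g"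
  proof -
    have "transpose (map_matrix of_int N) = (map_matrix of_int N :: bit ^ 'g ^ 'g)"
      by (simp add: transpose_map_matrix N)
    moreover have "(\<chi> i. of_int (N $ i $ i)) = (map_vec of_int (\<chi> i. N $ i $ i) :: bit ^ 'g)"
      by (simp add: vec_eq_iff)
    ultimately show ?thesis
      using bit_symmetric_form[of "map_matrix of_int N" "map_vec of_int m"]
      by (simp add: of_int_bit_eq_iff[symmetric] of_int_pair map_vec_of_int_matrix_vector)
  qed
  have "theta_const \<beta> ?\<tau>' = (\<Sum>\<^sub>\<infinity>n. let m = transpose B *v n in
      exp (of_real pi * \<i> * pair (e m) (?\<tau>' *v e m) + of_real pi * \<i> * of_int (pair \<beta> m)))"
    unfolding theta_const_def e_def Let_def by (rule infsum_reindex_bij_betw[OF bij, symmetric])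
  also have "\<dots> = theta_const ?\<gamma> \<tau>"
    unfolding theta_const_def
  proof (rule infsum_cong)
    fix n :: "int ^ 'g"
    define m where "m = transpose B *v n"
    have n: "transpose A *v m = n" unfolding m_def by (rule BA')
    have "exp (of_real pi * \<i> * pair (e m) (?\<tau>' *v e m) + of_real pi * \<i> * of_int (pair \<beta> m))
        = exp (of_real pi * \<i> * pair (e n) (\<tau> *v e n) + of_real pi * \<i> * of_int (pair \<beta> m + pair m (N *v m)))"
      unfolding quad n by (simp add: algebra_simps)
    also have "\<dots> = exp (of_real pi * \<i> * pair (e n) (\<tau> *v e n) + of_real pi * \<i> * of_int (pair (\<beta> + (\<chi> i. N $ i $ i)) m))"
      unfolding pair_add_left by (intro exp_pi_i_cong cong_add parity cong_refl)
    also have "pair (\<beta> + (\<chi> i. N $ i $ i)) m = pair ?\<gamma> n"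
      unfolding m_def pair_matrix_vector transpose_transpose ..
    finally show "(let m = transpose B *v n in
        exp (of_real pi * \<i> * pair (e m) (?\<tau>' *v e m) + of_real pi * \<i> * of_int (pair \<beta> m)))
      = exp (of_real pi * \<i> * pair (map_vec of_int n) (\<tau> *v map_vec of_int n) + of_real pi * \<i> * of_int (pair ?\<gamma> n))"
      by (simp add: Let_def m_def e_def)
  qed
  finally show ?thesis .
qed

lemma siegel_real_Re:
  assumes "\<tau> \<in> siegel_real l"
  shows "Re (\<tau> $ i $ j) = of_int (type_matrix l $ i $ j) / 2"
proof -
  have "2 *\<^sub>R map_matrix Re \<tau> = map_matrix of_int (type_matrix l)"
    using assms by (simp add: siegel_real_def)
  then have "(2 *\<^sub>R map_matrix Re \<tau>) $ i $ j = map_matrix of_int (type_matrix l) $ i $ j" by simp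
  then show ?thesis by simp
qed

text \<open>The real part of \<open>m^T \<tau> m\<close> is \<open>m^T M m / 2 = q(m)\<close>, an
  integer, so the exponent of each term has imaginary part an integer multiple of \<open>pi\<close>
  and the term is real. Conjugation commutes with the infinite sum.\<close>

lemma theta_const_real:
  assumes "even l" "\<tau> \<in> siegel_real l"
  shows "theta_const \<beta> \<tau> \<in> \<real>"
proof -
  have real: "exp (of_real pi * \<i> * pair (map_vec of_int m) (\<tau> *v map_vec of_int m)
          + of_real pi * \<i> * of_int (pair \<beta> m)) \<in> \<real>" (is "exp ?z \<in> _") for m
  proof -
    have "Re (pair (map_vec of_int m) (\<tau> *v map_vec of_int m)) = of_int (pair m (type_matrix l *v m)) / 2"
      by (simp add: pair_def matrix_vector_mult_def siegel_real_Re[OF assms(2)]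
          flip: sum_divide_distrib)
    also have "\<dots> = of_int (type_form l m)"
      using pair_type_mat_self[OF assms(1), of m] by (simp add: type_mat_int)
    finally have "Im ?z = of_int (type_form l m + pair \<beta> m) * pi"
      by (simp add: algebra_simps)
    then have "Im (exp ?z) = 0"
      by (simp only: Im_exp sin_times_pi_eq_0 Ints_of_int mult_eq_0_iff simp_thms)
    then show ?thesis by (simp add: complex_is_Real_iff)
  qed
  then have "cnj (theta_const \<beta> \<tau>) = theta_const \<beta> \<tau>"
    unfolding theta_const_def infsum_cnj[symmetric] by (intro infsum_cong) (simp only: Reals_cnj_iff)
  then show ?thesis by (simp only: Reals_cnj_iff)
qed

section \<open>Invariance under the real modular group\<close>

lemma half_defect_eq:
  assumes "\<And>i j. [type_matrix l $ i $ j = (A ** type_matrix l ** transpose A) $ i $ j] (mod 2)"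
  shows "2 * half_defect l A $ i $ j = type_matrix l $ i $ j - (A ** type_matrix l ** transpose A) $ i $ j"
  using assms[of i j] by (simp add: half_defect_def cong_iff_dvd_diff)

lemma transpose_half_defect: "transpose (half_defect l A) = half_defect l A"
proof -
  have "transpose (A ** type_matrix l ** transpose A) = A ** type_matrix l ** transpose A"
    by (simp add: matrix_transpose_mul transpose_type_matrix matrix_mul_assoc)
  then have "(A ** type_matrix l ** transpose A) $ i $ j = (A ** type_matrix l ** transpose A) $ j $ i" for i j
    by (metis transpose_nth)
  then show ?thesis
    by (simp add: vec_eq_iff half_defect_def type_matrix_sym[of l])
qed

text \<open>The diagonal of \<open>A M A^T\<close> consists of \<open>2 q\<close> of the rows, that
  of \<open>M\<close> is zero, and signs disappear modulo 2. This identifies the shift of the theta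
  characteristic with the defect vector of the isometry.\<close>

lemma half_defect_diagonal:
  assumes l: "even l"
    and cong: "\<And>i j. [type_matrix l $ i $ j = (A ** type_matrix l ** transpose A) $ i $ j] (mod 2)"
  shows "class2 (\<chi> i. half_defect l A $ i $ i) = (\<chi> i. type_form l (row i (map_matrix of_int A)))"
proof -
  have "half_defect l A $ i $ i = - type_form l (row i A)" for i
  proof -
    have "(A ** type_matrix l ** transpose A) $ i $ i = pair (axis i 1) (A *v (type_matrix l *v (transpose A *v axis i 1)))"
      by (simp add: pair_axis_left matrix_vector_axis matrix_vector_mul_assoc matrix_mul_assoc del: transpose_matrix_vector)
    also have "\<dots> = pair (row i A) (type_matrix l *v row i A)"
    proof -
      have "transpose A *v axis i 1 = row i A"
        by (simp add: vec_eq_iff matrix_vector_axis row_def del: transpose_matrix_vector)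
      then show ?thesis unfolding pair_matrix_vector[of _ A] by (simp only:)
    qed
    also have "\<dots> = 2 * type_form l (row i A)"
      using pair_type_mat_self[OF l, of "row i A"] by (simp add: type_mat_int)
    finally show ?thesis
      using half_defect_eq[OF cong, of i i] by (simp add: type_matrix_diagonal[OF l])
  qed
  moreover have "map_vec of_int (row i A) = (row i (map_matrix of_int A) :: (bit, 'a) vec)" for i
    by (simp add: vec_eq_iff row_def)
  moreover have "(of_int (- k) :: bit) = of_int k" for k by (simp only: of_int_bit even_minus)
  ultimately have "(of_int (half_defect l A $ i $ i) :: bit) = type_form l (row i (map_matrix of_int A))" for i
    by (metis of_int_type_form)
  then show ?thesis by (simp add: class2_def vec_eq_iff)
qed

text \<open>The permutation is \<open>T\<close>, the change of characteristic reduced modulo 2: an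
  injective self-map of a finite set. The parameter \<open>c\<close> covers both families at
  once.\<close>

lemma equal_up_to_permutation_classes:
  fixes A :: "(int, 'g::{finite,linorder}) sqmat"
  assumes l: "even l" "l \<le> CARD('g)" and A: "invertible A"
    and cong: "\<And>i j. [type_matrix l $ i $ j = (A ** type_matrix l ** transpose A) $ i $ j] (mod 2)"
    and \<tau>': "\<tau>' = map_matrix of_int A ** \<tau> ** transpose (map_matrix of_int A) + map_matrix of_int (half_defect l A)"
  shows "equal_up_to_permutation {b. type_form l b = c \<and> supported l b}
    (\<lambda>b. theta_class b \<tau>') (\<lambda>b. theta_class b \<tau>)" (is "equal_up_to_permutation ?I _ _")
proof -
  let ?B = "matrix_inv A"
  let ?d = "\<chi> i. half_defect l A $ i $ i"
  define A2 B2 :: "(bit, 'g) sqmat" where "A2 = map_matrix of_int A" and "B2 = map_matrix of_int ?B"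
  define d where "d = class2 ?d"
  define T where "T b = B2 *v (b + d)" for b
  note AB = invertible_matrix_inv[OF A]
  have AB2: "A2 ** B2 = mat 1" "B2 ** A2 = mat 1"
    unfolding A2_def B2_def map_matrix_of_int_mult[symmetric] AB map_matrix_of_int_mat1 by simp_all
  have iso: "A2 ** type_mat l ** transpose A2 = type_mat l"
    using cong of_int_bit_eq_iff
    unfolding A2_def type_mat_def transpose_map_matrix map_matrix_of_int_mult[symmetric] vec_eq_iff nth_map_matrix
    by (metis (no_types))
  have d: "d = (\<chi> i. type_form l (row i A2))"
    unfolding d_def A2_def by (rule half_defect_diagonal[OF l(1) cong])
  have "A2 *v T b = b + d" for b
    by (simp add: T_def matrix_vector_mul_assoc AB2)
  then have "inj T" by (metis injI add_right_imp_eq)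
  moreover have "T ` ?I \<subseteq> ?I"
    using isometry_shift[OF l iso AB2(2) d] by (auto simp: T_def)
  ultimately have "bij_betw T ?I ?I"
    unfolding bij_betw_def using endo_inj_surj[of ?I T] by (auto intro: inj_on_subset)
  moreover have "theta_class b \<tau>' = theta_class (T b) \<tau>" for b
  proof -
    have "theta_class b \<tau>' = theta_const (?B *v (map_vec of_bit b + ?d)) \<tau>"
      unfolding theta_class_def \<tau>' by (rule theta_const_transform[OF AB transpose_half_defect])
    also have "\<dots> = theta_class (class2 (?B *v (map_vec of_bit b + ?d))) \<tau>"
      by (simp only: theta_class_class2)
    also have "class2 (?B *v (map_vec of_bit b + ?d)) = T b"
      using class2_surj[of b]
      by (simp add: class2_def map_vec_of_int_matrix_vector map_vec_of_int_add T_def B2_def d_def)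
    finally show ?thesis .
  qed
  ultimately show ?thesis unfolding equal_up_to_permutation_def by blast
qed

section \<open>Homomorphisms of complex tori\<close>

lemma lattice_closed:
  assumes "lattice L"
  shows "0 \<in> L" "x \<in> L \<Longrightarrow> y \<in> L \<Longrightarrow> x - y \<in> L" "x \<in> L \<Longrightarrow> y \<in> L \<Longrightarrow> x + y \<in> L"
proof -
  show 0: "0 \<in> L" and diff: "x \<in> L \<Longrightarrow> y \<in> L \<Longrightarrow> x - y \<in> L" for x y
    using assms by (auto simp: lattice_def)
  show "x \<in> L \<Longrightarrow> y \<in> L \<Longrightarrow> x + y \<in> L"
    using diff[of x "0 - y"] diff[of 0 y] 0 by simp
qed

lemma lattice_separation:
  assumes "lattice L"
  obtains e where "e > 0" "\<And>x. x \<in> L \<Longrightarrow> norm x < e \<Longrightarrow> x = 0"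
  using assms unfolding lattice_def by (metis not_le)

lemma coset_eq_iff:
  assumes "lattice L"
  shows "z +o L = w +o L \<longleftrightarrow> z - w \<in> L"
proof
  assume "z +o L = w +o L"
  then have "z \<in> w +o L" using lattice_closed(1)[OF assms] by (metis add.right_neutral set_plus_intro2)
  then show "z - w \<in> L" by (auto simp: elt_set_plus_def)
next
  have sub: "z +o L \<subseteq> w +o L" if "z - w \<in> L" for z w
  proof
    fix x assume "x \<in> z +o L"
    then obtain c where "c \<in> L" "x = z + c" by (auto simp: elt_set_plus_def)
    then have "x = w + ((z - w) + c)" "(z - w) + c \<in> L" using that lattice_closed[OF assms] by auto
    then show "x \<in> w +o L" by (metis set_plus_intro2)
  qed
  assume "z - w \<in> L"
  moreover from this have "w - z \<in> L" using lattice_closed(2)[OF assms lattice_closed(1)[OF assms]] by fastforce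
  ultimately show "z +o L = w +o L" using sub by blast
qed

lemma coset_add:
  assumes "lattice L"
  shows "(z +o L) + (w +o L) = (z + w) +o L"
proof -
  have "L + L = L"
    unfolding set_plus_def using lattice_closed[OF assms] by (auto intro: bexI[of _ 0])
  then show ?thesis by (simp add: set_plus_rearrange)
qed

text \<open>A lattice is uniformly discrete, while a connected image with more than one point has no
  isolated point.\<close>

lemma continuous_into_lattice_constant:
  assumes L: "lattice L" and S: "connected S" and h: "continuous_on S h" "h ` S \<subseteq> L"
    and "x \<in> S" "y \<in> S"
  shows "h x = h y"
proof -
  obtain e where e: "e > 0" "\<And>x. x \<in> L \<Longrightarrow> norm x < e \<Longrightarrow> x = 0" using lattice_separation[OF L] by blast
  have "\<not> h x islimpt h ` S"
  proof
    assume "h x islimpt h ` S"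
    then obtain u where "u \<in> S" "h u \<noteq> h x" "norm (h u - h x) < e"
      using e(1) unfolding islimpt_approachable dist_norm by blast
    then show False
      using e(2)[of "h u - h x"] h(2) \<open>x \<in> S\<close> lattice_closed(2)[OF L, of "h u" "h x"] by auto
  qed
  then obtain c where "h ` S = {c}"
    using connected_imp_perfect[OF connected_continuous_image[OF h(1) S]] \<open>x \<in> S\<close> by blast
  then show ?thesis using \<open>x \<in> S\<close> \<open>y \<in> S\<close> by (metis imageI singletonD)
qed

text \<open>Turns an identity of linear maps modulo the lattice into an exact one.\<close>

lemma linear_into_lattice_zero:
  assumes "lattice L" "linear h" "\<And>z. h z \<in> L"
  shows "h (z :: 'a::euclidean_space) = 0"
proof -
  have "h z = h 0"
    using assms by (intro continuous_into_lattice_constant[OF assms(1), of UNIV])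
      (auto intro: linear_continuous_on simp: linear_conv_bounded_linear)
  then show ?thesis using linear_0[OF assms(2)] by simp
qed

text \<open>Any lift of the image path differs from \<open>t *\<^sub>R D c\<close> by a continuous
  map into \<open>L'\<close>, a constant, which drops out of the difference of the
  endpoints.\<close>

lemma H1_map_linear:
  assumes L': "lattice L'" and D: "linear D" and f: "\<And>z. f (z +o L) = D z +o L'"
  shows "H1_map L L' f c = D c"
  unfolding H1_map_def
proof (rule the_equality)
  show "\<exists>\<gamma>. path \<gamma> \<and> (\<forall>t\<in>{0..1}. \<gamma> t +o L' = f ((t *\<^sub>R c) +o L)) \<and> D c = pathfinish \<gamma> - pathstart \<gamma>"
    by (intro exI[of _ "\<lambda>t. t *\<^sub>R D c"])
       (auto simp: f linear_scale[OF D] path_def pathfinish_def pathstart_def intro!: continuous_intros)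
  fix d assume "\<exists>\<gamma>. path \<gamma> \<and> (\<forall>t\<in>{0..1}. \<gamma> t +o L' = f ((t *\<^sub>R c) +o L)) \<and> d = pathfinish \<gamma> - pathstart \<gamma>"
  then obtain \<gamma> where g: "path \<gamma>" "\<And>t. t \<in> {0..1} \<Longrightarrow> \<gamma> t - t *\<^sub>R D c \<in> L'" "d = \<gamma> 1 - \<gamma> 0"
    by (auto simp: f linear_scale[OF D] pathfinish_def pathstart_def coset_eq_iff[OF L'])
  have "\<gamma> 1 - 1 *\<^sub>R D c = \<gamma> 0 - 0 *\<^sub>R D c"
    using g(1,2) unfolding path_def
    by (intro continuous_into_lattice_constant[OF L', of "{0..1}" "\<lambda>t. \<gamma> t - t *\<^sub>R D c"] continuous_intros) auto
  then show "d = D c" using g(3) by (simp add: algebra_simps)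
qed

text \<open>
  A local lift normalized to vanish at the origin is additive up to elements of the lattice that are
  too short to be nonzero, so it satisfies \<open>G z = n G (z / n)\<close> and agrees with its derivative.
\<close>

lemma torus_hom_lift:
  fixes L :: "(complex ^ 'g) set" and L' :: "(complex ^ 'h) set"
  assumes L: "lattice L" and L': "lattice L'" and hol: "torus_holomorphic L L' f"
    and hom: "\<And>x y. x \<in> torus L \<Longrightarrow> y \<in> torus L \<Longrightarrow> f (x + y) = f x + f y"
  obtains D where "linear D" "\<And>c x. D (c *s x) = c *s D x" "\<And>z. f (z +o L) = D z +o L'"
proof -
  have f_add: "f ((z + w) +o L) = f (z +o L) + f (w +o L)" for z w
    using hom[of "z +o L" "w +o L"] by (simp add: torus_def coset_add[OF L])
  obtain U F where U: "open U" "0 \<in> U" and F: "\<And>z. z \<in> U \<Longrightarrow> f (z +o L) = F z +o L'"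
    and "holomorphic_map_on U F"
    using hol[unfolded torus_holomorphic_def, rule_format, of 0] by auto
  then obtain D where deriv: "(F has_derivative D) (at 0)" and D: "\<And>c x. D (c *s x) = c *s D x"
    unfolding holomorphic_map_on_def by blast
  have lin: "linear D" using deriv by (rule has_derivative_linear)
  obtain e where e: "e > 0" "\<And>x. x \<in> L' \<Longrightarrow> norm x < e \<Longrightarrow> x = 0" using lattice_separation[OF L'] by blast
  obtain r where r: "r > 0" "ball 0 r \<subseteq> U" using U openE by blast
  have "isCont F 0" using deriv has_derivative_continuous by blast
  \<comment> \<open>A third of the separation \<open>e\<close>, because the additivity defect of
    \<open>G\<close> combines three values.\<close>
  then obtain s where s: "s > 0" "\<And>z. norm z < s \<Longrightarrow> norm (F z - F 0) < e / 3"
    using e(1) unfolding continuous_at_eps_delta dist_norm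
    by (metis diff_zero divide_pos_pos zero_less_numeral)
  define G where "G z = F z - F 0" for z
  define \<delta> where "\<delta> = min r s"
  have \<delta>: "\<delta> > 0" using r s by (simp add: \<delta>_def)
  \<comment> \<open>The neutral coset goes to an idempotent, hence to \<open>L'\<close>, so
    subtracting \<open>F 0\<close> does not change cosets.\<close>
  have "F 0 +o L' = (F 0 + F 0) +o L'"
    using f_add[of 0 0] F[OF U(2)] by (metis add.left_neutral coset_add[OF L'])
  then have F0: "F 0 \<in> L'"
    using lattice_closed(2)[OF L' lattice_closed(1)[OF L']] by (fastforce simp: coset_eq_iff[OF L'])
  have fG: "f (z +o L) = G z +o L'" if "norm z < \<delta>" for z
  proof -
    have "f (z +o L) = F z +o L'" using F r that by (auto simp: \<delta>_def)
    then show ?thesis using F0 by (simp add: G_def coset_eq_iff[OF L'])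
  qed
  have G_add: "G (z + w) = G z + G w" if zw: "norm z < \<delta>" "norm w < \<delta>" "norm (z + w) < \<delta>" for z w
  proof -
    have "G (z + w) +o L' = (G z + G w) +o L'"
      using f_add[of z w] zw by (simp add: fG coset_add[OF L'])
    then have "G (z + w) - (G z + G w) \<in> L'" by (simp add: coset_eq_iff[OF L'])
    moreover have "norm (G (z + w) - (G z + G w)) < e"
    proof -
      have "norm (G (z + w)) < e / 3" "norm (G z) < e / 3" "norm (G w) < e / 3"
        using s(2) zw by (auto simp: G_def \<delta>_def)
      then show ?thesis
        using norm_triangle_ineq4[of "G (z + w)" "G z + G w"] norm_triangle_ineq[of "G z" "G w"] by linarith
    qed
    ultimately show ?thesis using e(2) by fastforce
  qed
  have G_scale: "G (real k *\<^sub>R w) = real k *\<^sub>R G w" if "norm (real k *\<^sub>R w) < \<delta>" for k w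
    using that
  proof (induction k)
    case 0
    then show ?case by (simp add: G_def)
  next
    case (Suc k)
    have "real k * norm w \<le> real (Suc k) * norm w" "1 * norm w \<le> real (Suc k) * norm w"
      by (intro mult_right_mono; simp)+
    with Suc.prems have "norm (real k *\<^sub>R w) < \<delta>" "norm w < \<delta>" by simp_all
    with Suc show ?case using G_add[of "real k *\<^sub>R w" w] by (simp add: scaleR_add_left add.commute)
  qed
  have GD: "G z = D z" if z: "norm z < \<delta>" for z
  proof (cases "z = 0")
    case True
    then show ?thesis by (simp add: G_def linear_0[OF lin])
  next
    case False
    \<comment> \<open>At \<open>z / n\<close> the error is at most \<open>\<epsilon> / n\<close>
      once \<open>n\<close> is large; homogeneity multiplies it by \<open>n\<close>.\<close>
    have "norm (G z - D z) \<le> \<epsilon>" if "\<epsilon> > 0" for \<epsilon>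
    proof -
      have "\<epsilon> / norm z > 0" using that False by simp
      then obtain d where d: "d > 0" "\<And>y. norm y < d \<Longrightarrow> norm (F y - F 0 - D y) \<le> \<epsilon> / norm z * norm y"
        using deriv unfolding has_derivative_at_alt by (metis diff_zero)
      obtain n where n: "norm z / d < real n" using reals_Archimedean2 by blast
      have "0 < norm z / d" using d False by simp
      then have n0: "0 < real n" using n by linarith
      define y where "y = (1 / real n) *\<^sub>R z"
      have y: "real n *\<^sub>R y = z" using n0 by (simp add: y_def)
      have "norm y < d" using n n0 d by (simp add: y_def field_simps)
      then have "norm (G y - D y) \<le> \<epsilon> / norm z * norm y" using d by (simp add: G_def)
      then have "real n * norm (G y - D y) \<le> real n * (\<epsilon> / norm z * norm y)"
        by (rule mult_left_mono) simp
      also have "\<dots> = \<epsilon>" using n0 False by (simp add: y_def)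
      also have "real n * norm (G y - D y) = norm (real n *\<^sub>R G y - real n *\<^sub>R D y)"
        by (simp flip: scaleR_diff_right)
      also have "\<dots> = norm (G z - D z)"
        using G_scale[of n y] z linear_scale[OF lin, of "real n" y] by (simp add: y)
      finally show ?thesis .
    qed
    then have "norm (G z - D z) \<le> 0" by (rule field_le_epsilon[of _ 0, simplified])
    then show ?thesis by simp
  qed
  \<comment> \<open>\<open>G\<close> describes \<open>f\<close> only near 0, but every
    \<open>z\<close> is a multiple \<open>n w\<close> of a small \<open>w\<close>, and
    \<open>f\<close> is additive everywhere.\<close>
  have "f (z +o L) = D z +o L'" for z
  proof -
    obtain n where n: "norm z / \<delta> < real n" using reals_Archimedean2 by blast
    have "0 \<le> norm z / \<delta>" using \<delta> by simp
    then have n0: "0 < real n" using n by linarith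
    define w where "w = (1 / real n) *\<^sub>R z"
    have w: "real n *\<^sub>R w = z" using n0 by (simp add: w_def)
    have "norm w < \<delta>" using n n0 \<delta> by (simp add: w_def field_simps)
    then have fw: "f (w +o L) = D w +o L'" using fG GD by simp
    have "f ((real k *\<^sub>R w) +o L) = (real k *\<^sub>R D w) +o L'" for k
    proof (induction k)
      case 0
      then show ?case using fG[of 0] GD[of 0] \<delta> by (simp add: linear_0[OF lin])
    next
      case (Suc k)
      then show ?case using f_add[of "real k *\<^sub>R w" w] fw
        by (simp add: scaleR_add_left coset_add[OF L'] add.commute)
    qed
    from this[of n] show ?thesis unfolding w linear_scale[OF lin, symmetric] .
  qed
  then show ?thesis using that lin D by blast
qed

section \<open>Real isomorphisms come from the real modular group\<close>

text \<open>Over the field of real numbers one-sided inverses are two-sided, and the integers embed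
  injectively.\<close>

lemma int_matrix_left_right_inverse:
  fixes A B :: "int ^ 'n ^ 'n"
  assumes "A ** B = mat 1"
  shows "B ** A = mat 1"
proof -
  let ?r = "map_matrix real_of_int :: int ^ 'n ^ 'n \<Rightarrow> _"
  have "?r A ** ?r B = mat 1"
    unfolding map_matrix_of_int_mult[symmetric] assms by (rule map_matrix_of_int_mat1)
  then have "?r (B ** A) = ?r (mat 1)"
    unfolding map_matrix_of_int_mult map_matrix_of_int_mat1 by (simp add: matrix_left_right_inverse)
  then show ?thesis by (simp add: vec_eq_iff)
qed

lemma siegel_Im_injective:
  fixes \<tau> :: "complex ^ 'g ^ 'g" and x :: "real ^ 'g"
  assumes "\<tau> \<in> siegel" "map_vec Im (\<tau> *v map_vec of_real x) = 0"
  shows "x = 0"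
proof (rule ccontr)
  assume "x \<noteq> 0"
  then have "0 < x \<bullet> (map_matrix Im \<tau> *v x)" using assms(1) by (simp add: siegel_def)
  also have "map_matrix Im \<tau> *v x = map_vec Im (\<tau> *v map_vec of_real x)"
    by (simp add: vec_eq_iff matrix_vector_mult_def)
  finally show False using assms(2) by simp
qed

lemma inj_period_map:
  assumes "\<tau> \<in> siegel"
  shows "inj (period_map \<tau>)"
proof (rule injI, clarify)
  fix a b a' b' :: "real ^ 'a"
  assume eq: "period_map \<tau> (a, b) = period_map \<tau> (a', b')"
  have "\<tau> *v map_vec of_real (b - b') = map_vec of_real (a' - a)"
  proof -
    have *: "map_vec of_real (x - y) = (map_vec of_real x - map_vec of_real y :: complex ^ 'a)" for x y
      by (simp add: vec_eq_iff)
    show ?thesis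
      using eq unfolding * by (simp add: period_map_def matrix_vector_mult_diff_distrib algebra_simps)
  qed
  then have "map_vec Im (\<tau> *v map_vec of_real (b - b')) = 0" by (simp add: vec_eq_iff)
  then have "b - b' = 0" by (rule siegel_Im_injective[OF assms])
  then have "b = b'" by simp
  moreover have "a = a'" using eq unfolding \<open>b = b'\<close> by (simp add: period_map_def vec_eq_iff)
  ultimately show "a = a' \<and> b = b'" by simp
qed

lemma standard_form_integral:
  assumes "\<tau> \<in> siegel"
  shows "standard_form \<tau> (map_vec of_int m + \<tau> *v map_vec of_int n) (map_vec of_int m' + \<tau> *v map_vec of_int n')
    = of_int (pair m n' - pair n m')"
proof -
  let ?r = "map_vec real_of_int :: int ^ 'a \<Rightarrow> _"
  have P: "map_vec of_int m + \<tau> *v map_vec of_int n = period_map \<tau> (?r m, ?r n)" for m n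
    by (simp add: period_map_def map_vec_def)
  show ?thesis
    unfolding P standard_form_def inv_f_f[OF inj_period_map[OF assms]]
    by (simp add: inner_vec_def pair_def)
qed

text \<open>The condition \<open>2 Re \<tau> = M\<close> says that the conjugate of
  \<open>\<tau>\<close> is \<open>M - \<tau>\<close>.\<close>

lemma siegel_real_vcnj:
  assumes "\<tau> \<in> siegel_real l"
  shows "vcnj (\<tau> *v map_vec of_int n) = map_vec of_int (type_matrix l *v n) - \<tau> *v map_vec of_int n"
proof -
  have "cnj (\<tau> $ i $ j) = of_int (type_matrix l $ i $ j) - \<tau> $ i $ j" for i j
    using siegel_real_Re[OF assms, of i j] by (simp add: complex_eq_iff)
  then show ?thesis
    by (simp add: vec_eq_iff vcnj_def matrix_vector_mult_def left_diff_distrib sum_subtractf)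
qed

lemma vcnj_add: "vcnj (z + w) = vcnj z + vcnj w"
  by (simp add: vcnj_def vec_eq_iff)

lemma vcnj_vcnj: "vcnj (vcnj z) = z"
  by (simp add: vcnj_def vec_eq_iff)

lemma linear_vcnj: "linear vcnj"
  by (intro linearI) (simp_all add: vcnj_def vec_eq_iff)

lemma S_conj_coset:
  assumes "\<tau> \<in> siegel_real l"
  shows "S_conj (z +o period_lattice \<tau>) = vcnj z +o period_lattice \<tau>"
proof -
  have sub: "vcnj x \<in> period_lattice \<tau>" if x_in: "x \<in> period_lattice \<tau>" for x
  proof -
    obtain m n where x: "x = map_vec of_int m + \<tau> *v map_vec of_int n"
      using x_in by (auto simp: period_lattice_def)
    have "vcnj x = map_vec of_int (m + type_matrix l *v n) + \<tau> *v map_vec of_int (- n)"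
    proof -
      have "map_vec of_int (- n) = (- map_vec of_int n :: (complex, 'a) vec)" by (simp add: vec_eq_iff)
      moreover have "\<tau> *v (- y) = - (\<tau> *v y)" for y
        by (simp add: vec_eq_iff matrix_vector_mult_def sum_negf)
      moreover have "vcnj (map_vec of_int m :: (complex, 'a) vec) = map_vec of_int m"
        by (simp add: vec_eq_iff vcnj_def)
      ultimately show ?thesis
        by (simp add: x vcnj_add siegel_real_vcnj[OF assms] map_vec_of_int_add)
    qed
    then show ?thesis unfolding period_lattice_def by blast
  qed
  then have "vcnj ` period_lattice \<tau> = period_lattice \<tau>"
    using vcnj_vcnj by (metis image_eqI image_subset_iff subsetI subset_antisym)
  moreover have "S_conj (z +o period_lattice \<tau>) = vcnj z +o (vcnj ` period_lattice \<tau>)"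
    unfolding S_conj_def elt_set_plus_def by (auto simp: vcnj_add[symmetric])
  ultimately show ?thesis by simp
qed

lemma period_lattice_columns:
  "axis j 1 \<in> period_lattice \<tau>" "\<tau> *v axis j 1 \<in> period_lattice \<tau>"
proof -
  have "axis j 1 = map_vec of_int (axis j 1) + \<tau> *v map_vec of_int 0"
    "\<tau> *v axis j 1 = map_vec of_int 0 + \<tau> *v map_vec of_int (axis j 1)"
    by (simp_all add: map_vec_of_int_axis map_vec_of_int_zero)
  then show "axis j 1 \<in> period_lattice \<tau>" "\<tau> *v axis j 1 \<in> period_lattice \<tau>"
    unfolding period_lattice_def by blast+
qed

text \<open>Definiteness of the imaginary part of \<open>\<tau>\<close> forces the coefficients of
  its columns in a real period to vanish.\<close>

lemma real_period:
  assumes \<tau>: "\<tau> \<in> siegel" and z: "z \<in> period_lattice \<tau>" "vcnj z = z"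
  obtains m where "z = map_vec of_int m"
proof -
  obtain m n where mn: "z = map_vec of_int m + \<tau> *v map_vec of_int n"
    using z(1) by (auto simp: period_lattice_def)
  have "Im (z $ i) = 0" for i
    using z(2) by (metis Reals_cnj_iff complex_is_Real_iff map_vec_nth vcnj_def)
  then have "map_vec Im (\<tau> *v map_vec of_real (map_vec real_of_int n)) = 0"
    by (simp add: mn vec_eq_iff map_vec_def)
  then have "map_vec real_of_int n = 0" by (rule siegel_Im_injective[OF \<tau>])
  then have "n = 0" by (simp add: vec_eq_iff)
  then show ?thesis using that[of m] mn by (simp add: map_vec_def zero_vec_def[symmetric])
qed

lemma real_isomorphic_modular:
  fixes \<tau> \<tau>' :: "(complex, 'g::{finite,linorder}) sqmat"
  assumes \<tau>: "\<tau> \<in> siegel_real l" and \<tau>': "\<tau>' \<in> siegel_real l"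
    and iso: "real_isomorphic (real_av_of \<tau>) (real_av_of \<tau>')"
  obtains A :: "(int, 'g) sqmat" where "invertible A"
    and "\<And>i j. [type_matrix l $ i $ j = (A ** type_matrix l ** transpose A) $ i $ j] (mod 2)"
    and "\<tau>' = map_matrix of_int A ** \<tau> ** transpose (map_matrix of_int A) + map_matrix of_int (half_defect l A)"
proof -
  define L where "L = period_lattice \<tau>"
  define L' where "L' = period_lattice \<tau>'"
  have siegel: "\<tau> \<in> siegel" "\<tau>' \<in> siegel" using \<tau> \<tau>' by (simp_all add: siegel_real_def)
  have L: "lattice L" and L': "lattice L'"
    using iso by (simp_all add: real_isomorphic_def real_ppav_def Let_def real_av_of_def L_def L'_def)
  obtain f where "ppav_isomorphism (real_av_of \<tau>) (real_av_of \<tau>') f"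
    and conj: "\<And>x. x \<in> torus L \<Longrightarrow> f (S_conj x) = S_conj (f x)"
    using iso by (auto simp: real_isomorphic_def real_av_of_def L_def)
  then have hol: "torus_holomorphic L L' f"
    and hom: "\<And>x y. x \<in> torus L \<Longrightarrow> y \<in> torus L \<Longrightarrow> f (x + y) = f x + f y"
    and form: "\<And>c d. c \<in> L \<Longrightarrow> d \<in> L \<Longrightarrow>
      standard_form \<tau>' (H1_map L L' f c) (H1_map L L' f d) = standard_form \<tau> c d"
    by (simp_all add: ppav_isomorphism_def Let_def real_av_of_def L_def L'_def)
  obtain D where lin: "linear D" and scale: "\<And>c x. D (c *s x) = c *s D x"
    and fD: "\<And>z. f (z +o L) = D z +o L'"
    using torus_hom_lift[OF L L' hol hom] by blast
  have H1: "H1_map L L' f c = D c" for c by (rule H1_map_linear[OF L' lin fD])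
  have DL: "D c \<in> L'" if "c \<in> L" for c
  proof -
    have "c +o L = 0 +o L" using that unfolding coset_eq_iff[OF L] by simp
    then have "D c +o L' = D 0 +o L'" by (metis fD)
    then show ?thesis unfolding linear_0[OF lin] coset_eq_iff[OF L'] by simp
  qed
  \<comment> \<open>On the tori the maps commute only modulo \<open>L'\<close>; the difference of
    the lifts is linear with values in \<open>L'\<close>, hence zero.\<close>
  have D_vcnj: "D (vcnj z) = vcnj (D z)" for z
  proof -
    have "D (vcnj z) - vcnj (D z) \<in> L'" for z
      using conj[of "z +o L"] S_conj_coset[OF \<tau>, of z] S_conj_coset[OF \<tau>', of "D z"]
      by (simp add: torus_def fD coset_eq_iff[OF L'] flip: L_def L'_def)
    moreover have "linear (\<lambda>z. D (vcnj z) - vcnj (D z))"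
      using linear_compose[OF linear_vcnj lin] linear_compose[OF lin linear_vcnj]
      by (intro linear_compose_sub) (simp_all add: o_def)
    ultimately have "D (vcnj z) - vcnj (D z) = 0" by (intro linear_into_lattice_zero[OF L'])
    then show ?thesis by simp
  qed
  have e_L: "axis j 1 \<in> L" and \<tau>e_L: "\<tau> *v axis j 1 \<in> L" for j
    unfolding L_def by (rule period_lattice_columns)+
  \<comment> \<open>Unit vectors are periods fixed by conjugation, and \<open>D\<close> carries them
    to periods of the same kind.\<close>
  have "\<exists>m. D (axis j 1) = map_vec of_int m" for j
  proof -
    have "vcnj (axis j 1) = axis j (1::complex)" by (simp add: vcnj_def vec_eq_iff axis_def)
    then have "vcnj (D (axis j 1)) = D (axis j 1)" by (metis D_vcnj)
    then show ?thesis using real_period[OF siegel(2)] DL[OF e_L] unfolding L'_def by blast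
  qed
  then obtain a where a: "\<And>j. D (axis j 1) = map_vec of_int (a j)" by metis
  have "\<exists>c k. D (\<tau> *v axis j 1) = map_vec of_int c + \<tau>' *v map_vec of_int k" for j
    using DL[OF \<tau>e_L] unfolding L'_def period_lattice_def by blast
  then obtain c k where ck: "\<And>j. D (\<tau> *v axis j 1) = map_vec of_int (c j) + \<tau>' *v map_vec of_int (k j)"
    by metis
  \<comment> \<open>The columns are the coordinates of the images of both halves of the basis:
    \<open>D\<close> acts as \<open>A\<close>, and \<open>A \<tau> = C + \<tau>' K\<close>.\<close>
  define A C K :: "(int, 'g) sqmat"
    where "A = (\<chi> i j. a j $ i)" and "C = (\<chi> i j. c j $ i)" and "K = (\<chi> i j. k j $ i)"
  let ?r = "map_matrix of_int :: (int, 'g) sqmat \<Rightarrow> (complex, 'g) sqmat"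
  have "D = (\<lambda>z. matrix D *v z)"
    using matrix_works[of D] lin scale
    by (simp add: Vector_Spaces.linear_def module_hom_def module_hom_axioms_def linear_add
        vec.vector_space_axioms vec.module_axioms fun_eq_iff)
  moreover have "matrix D = ?r A" by (simp add: matrix_def a A_def vec_eq_iff)
  ultimately have D: "D z = ?r A *v z" for z by metis
  have "(?r A ** \<tau>) *v axis j 1 = (?r C + \<tau>' ** ?r K) *v axis j 1" for j
  proof -
    have "?r C *v axis j 1 = map_vec of_int (c j)" "?r K *v axis j 1 = map_vec of_int (k j)"
      by (simp_all add: vec_eq_iff matrix_vector_axis C_def K_def)
    then show ?thesis
      using ck[of j] by (simp add: D matrix_vector_mult_add_rdistrib flip: matrix_vector_mul_assoc)
  qed
  then have period: "?r A ** \<tau> = ?r C + \<tau>' ** ?r K"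
    unfolding vec_eq_iff matrix_vector_axis by simp
  \<comment> \<open>Preservation of the pairing between the unit vectors and the columns of
    \<open>\<tau>\<close>.\<close>
  have "transpose A ** K = mat 1"
  proof -
    have "pair (a i) (k j) = (if i = j then 1 else 0)" for i j
    proof -
      have "of_int (pair (a i) (k j)) = standard_form \<tau>' (D (axis i 1)) (D (\<tau> *v axis j 1))"
        using standard_form_integral[OF siegel(2), of "a i" 0 "c j" "k j"]
        by (simp add: a ck map_vec_of_int_zero) (simp add: pair_def)
      also have "\<dots> = standard_form \<tau> (axis i 1) (\<tau> *v axis j 1)"
        using form[OF e_L \<tau>e_L] by (simp only: H1)
      also have "\<dots> = of_int (pair (axis i 1) (axis j 1 :: (int, 'g) vec))"
        using standard_form_integral[OF siegel(1), of "axis i 1" 0 0 "axis j 1"]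
        by (simp add: map_vec_of_int_zero map_vec_of_int_axis) (simp add: pair_def)
      finally have "pair (a i) (k j) = axis j 1 $ i" by (simp only: of_int_eq_iff pair_axis_left)
      then show ?thesis by (simp add: axis_def)
    qed
    then show ?thesis
      by (simp add: vec_eq_iff matrix_matrix_mult_def A_def K_def mat_def pair_def)
  qed
  then have AK: "K ** transpose A = mat 1" "A ** transpose K = mat 1" "transpose K ** A = mat 1"
    using int_matrix_left_right_inverse matrix_transpose_mul transpose_mat1 transpose_transpose
    by metis+
  then have inv: "invertible A" unfolding invertible_def by blast
  \<comment> \<open>Multiplying \<open>A \<tau> = C + \<tau>' K\<close> by \<open>A^T\<close> on the
    right and using \<open>K A^T = 1\<close> gives
    \<open>\<tau>' = A \<tau> A^T - C A^T\<close>.\<close>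
  define N where "N = - (C ** transpose A)"
  have "?r A ** \<tau> ** transpose (?r A) = ?r (C ** transpose A) + \<tau>' ** ?r (K ** transpose A)"
    unfolding period transpose_map_matrix map_matrix_of_int_mult
    by (simp add: matrix_add_mult_distrib matrix_mul_assoc)
  then have "?r A ** \<tau> ** transpose (?r A) = ?r (C ** transpose A) + \<tau>'"
    unfolding AK map_matrix_of_int_mat1 by simp
  moreover have "?r N = - ?r (C ** transpose A)" by (simp add: N_def vec_eq_iff)
  ultimately have act: "\<tau>' = ?r A ** \<tau> ** transpose (?r A) + ?r N" by simp
  \<comment> \<open>Twice the real parts of both period matrices is \<open>M\<close>, which yields
    the congruence modulo 2 and determines \<open>N\<close>.\<close>
  have MN: "type_matrix l $ i $ j = (A ** type_matrix l ** transpose A) $ i $ j + 2 * N $ i $ j" for i j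
  proof -
    have "2 * Re ((?r A ** \<tau> ** transpose (?r A)) $ i $ j) = of_int ((A ** type_matrix l ** transpose A) $ i $ j)"
      by (simp add: matrix_matrix_mult_def siegel_real_Re[OF \<tau>] flip: sum_divide_distrib)
    moreover have "2 * Re (\<tau>' $ i $ j) = of_int (type_matrix l $ i $ j)"
      by (simp add: siegel_real_Re[OF \<tau>'])
    ultimately have "real_of_int (type_matrix l $ i $ j) = of_int ((A ** type_matrix l ** transpose A) $ i $ j + 2 * N $ i $ j)"
      by (subst (asm) act) simp
    then show ?thesis by (simp only: of_int_eq_iff)
  qed
  have "N = half_defect l A"
    using MN by (simp add: vec_eq_iff half_defect_def)
  then show ?thesis
    using that[OF inv] MN act by (metis (no_types, lifting) cong_iff_lin cong_sym)
qed

theorem theorem1p1: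
  fixes \<tau> :: "(complex, 'g::{finite,linorder}) sqmat" and l :: nat
  assumes "orthosymmetric CARD('g) l 1"
    and "\<tau> \<in> siegel_real l"
  shows "(\<forall>b\<in>odd_classes l. theta_class b \<tau> \<in> \<real>) \<and>
    (\<forall>b\<in>even_classes l. theta_class b \<tau> \<in> \<real>) \<and>
    (\<forall>\<tau>'\<in>siegel_real l. (\<exists>G\<in>real_modular_group l. \<tau>' = modular_action l G \<tau>) \<longrightarrow>
       equal_up_to_permutation (odd_classes l) (\<lambda>b. theta_class b \<tau>') (\<lambda>b. theta_class b \<tau>) \<and>
       equal_up_to_permutation (even_classes l) (\<lambda>b. theta_class b \<tau>') (\<lambda>b. theta_class b \<tau>)) \<and>
    (\<forall>\<tau>'\<in>siegel_real l. real_isomorphic (real_av_of \<tau>) (real_av_of \<tau>') \<longrightarrow>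
       equal_up_to_permutation (odd_classes l) (\<lambda>b. theta_class b \<tau>') (\<lambda>b. theta_class b \<tau>) \<and>
       equal_up_to_permutation (even_classes l) (\<lambda>b. theta_class b \<tau>') (\<lambda>b. theta_class b \<tau>))"
proof -
  have l: "even l" "l \<le> CARD('g)"
    using assms(1) by (auto simp: orthosymmetric_def real_type_def)
  have real: "theta_class b \<tau> \<in> \<real>" for b
    unfolding theta_class_def by (rule theta_const_real[OF l(1) assms(2)])
  \<comment> \<open>An element of the modular group and a real isomorphism both supply such a matrix
    \<open>A\<close>.\<close>
  have perm: "equal_up_to_permutation (odd_classes l) (\<lambda>b. theta_class b \<tau>') (\<lambda>b. theta_class b \<tau>) \<and>
      equal_up_to_permutation (even_classes l) (\<lambda>b. theta_class b \<tau>') (\<lambda>b. theta_class b \<tau>)"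
    if "invertible A" "\<And>i j. [type_matrix l $ i $ j = (A ** type_matrix l ** transpose A) $ i $ j] (mod 2)"
      "\<tau>' = map_matrix of_int A ** \<tau> ** transpose (map_matrix of_int A) + map_matrix of_int (half_defect l A)"
    for A and \<tau>' :: "(complex, 'g) sqmat"
    unfolding odd_classes_eq[OF l(1)] even_classes_eq[OF l(1)]
    by (intro conjI equal_up_to_permutation_classes[OF l that])
  have "equal_up_to_permutation (odd_classes l) (\<lambda>b. theta_class b \<tau>') (\<lambda>b. theta_class b \<tau>) \<and>
      equal_up_to_permutation (even_classes l) (\<lambda>b. theta_class b \<tau>') (\<lambda>b. theta_class b \<tau>)"
    if G: "G \<in> real_modular_group l" and \<tau>': "\<tau>' = modular_action l G \<tau>" for G \<tau>'
  proof -
    obtain A where A: "invertible A"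
      and cong: "\<And>i j. [type_matrix l $ i $ j = (A ** type_matrix l ** transpose A) $ i $ j] (mod 2)"
      and "G = block_matrix A (half_defect l A ** matrix_inv (transpose A)) 0 (matrix_inv (transpose A))"
      using G unfolding real_modular_group_def by blast
    then have "upper_left G = A" by (simp add: upper_left_def block_matrix_def vec_eq_iff)
    then show ?thesis using \<tau>' by (intro perm[OF A cong]) (simp add: modular_action_def)
  qed
  moreover have "equal_up_to_permutation (odd_classes l) (\<lambda>b. theta_class b \<tau>') (\<lambda>b. theta_class b \<tau>) \<and>
      equal_up_to_permutation (even_classes l) (\<lambda>b. theta_class b \<tau>') (\<lambda>b. theta_class b \<tau>)"
    if "\<tau>' \<in> siegel_real l" "real_isomorphic (real_av_of \<tau>) (real_av_of \<tau>')" for \<tau>'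
    using real_isomorphic_modular[OF assms(2) that] perm by metis
  ultimately show ?thesis using real by blast
qed

end
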